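(* For each $N$ let $M=M^{(N)}=F\Lambda F^{\mathsf T}$, where: (1) $F=F^{(N)}$ is a random orthogonal $N\times N$ matrix such that (delocalization) almost surely, $\max_{i,j}|F_{ij}|=O(N^{-1/2+\epsilon})$ for every fixed $\epsilon>0$; and (invariance) $DFP\overset{d}{=}F$ for every deterministic diagonal matrix $D$ with $\pm1$ diagonal entries and every deterministic $N\times N$ permutation matrix $P$; (2) $\Lambda=\mathrm{diag}(\lambda_1,\dots,\lambda_N)$ is a deterministic diagonal matrix with $\|\Lambda\|_{\mathrm{op}}=O(1)$, $\mathrm{Tr}(\Lambda)/N=O(N^{-1/2+\epsilon})$ for every fixed $\epsilon>0$, and $\lim_{N\to\infty}\mathrm{Tr}(\Lambda^2)/N=\sigma_\psi^2\in(0,\infty)$. Then there exists a sequence of random matrices $\widetilde M=\widetilde M^{(N)}$ which is semi-random with probability $1$ (with constant $\sigma_\psi^2$) and satisfies $\widetilde M\overset{d}{=}M$ for each $N$.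
   Context: **Semi-random with probability 1.** A sequence of random matrices $\widetilde M^{(N)}\in\mathbb{R}^{N\times N}$ is semi-random with probability $1$ (with constant $\sigma_\psi^2$) if $\widetilde M^{(N)}=S\Psi S$, where $S=\mathrm{diag}(s_1,\dots,s_N)$ with $s_i$ i.i.d. uniform on $\{\pm1\}$, and $\Psi=\Psi^{(N)}$ is a sequence of random matrices, independent of $S$, such that with probability $1$ all of the following hold: (a) $\max_{i,j}|\psi_{ij}|=O(N^{-1/2+\epsilon})$ for every $\epsilon>0$; (b) $\|\Psi\|_{\mathrm{op}}=O(1)$; (c) $\max_{i\ne j}|(\Psi\Psi^{\mathsf T})_{ij}|=O(N^{-1/2+\epsilon})$ for every $\epsilon>0$; (d) $\max_{i}|(\Psi\Psi^{\mathsf T})_{ii}-\sigma_\psi^2|\to0$. $a_N=O(b_N)$ means $|a_N|\le\alpha b_N$ for all large $N$ and some constant $\alpha$ (which may depend on $\epsilon$, and on the realization for random quantities). The matrices for different $N$ are defined on a common probability space. *)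

theory Defs
  imports
    "HOL-Probability.Probability"
    "HOL-Library.Landau_Symbols"
    "Jordan_Normal_Form.Matrix"
begin

text \<open>Indices of an \<open>N \<times> N\<close> matrix run over \<open>{..<N}\<close>.\<close>

definition mat_trace :: "real mat \<Rightarrow> real" where
  "mat_trace A = (\<Sum>i<dim_row A. A $$ (i, i))"

definition l2norm_vec :: "real vec \<Rightarrow> real" where
  "l2norm_vec v = sqrt (scalar_prod v v)"

definition opnorm_mat :: "real mat \<Rightarrow> real" where
  "opnorm_mat A =
     (SUP v\<in>{v \<in> carrier_vec (dim_col A). l2norm_vec v \<le> 1}. l2norm_vec (A *\<^sub>v v))"

text \<open>The three maxima below are unspecified when they range over the empty set
  (matrices of size 0, and of size 1 for the off-diagonal one); they only occur in
  statements about \<open>N \<longrightarrow> \<infinity>\<close>.\<close>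

definition max_abs_entry :: "real mat \<Rightarrow> real" where
  "max_abs_entry A =
     Max ((\<lambda>(i, j). \<bar>A $$ (i, j)\<bar>) ` ({..<dim_row A} \<times> {..<dim_col A}))"

definition max_abs_offdiag :: "real mat \<Rightarrow> real" where
  "max_abs_offdiag A =
     Max ((\<lambda>(i, j). \<bar>A $$ (i, j)\<bar>) ` {(i, j). i < dim_row A \<and> j < dim_col A \<and> i \<noteq> j})"

definition max_diag_deviation :: "real mat \<Rightarrow> real \<Rightarrow> real" where
  "max_diag_deviation A c = Max ((\<lambda>i. \<bar>A $$ (i, i) - c\<bar>) ` {..<dim_row A})"

text \<open>The library predicate \<open>orthogonal_mat\<close> only asks for pairwise orthogonal nonzero
  columns, without normalisation.\<close>

definition orthonormal_mat :: "nat \<Rightarrow> real mat \<Rightarrow> bool" where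
  "orthonormal_mat n A \<longleftrightarrow> A \<in> carrier_mat n n \<and>
     transpose_mat A * A = 1\<^sub>m n \<and> A * transpose_mat A = 1\<^sub>m n"

definition sign_mats :: "nat \<Rightarrow> real mat set" where
  "sign_mats n = {mat_diag n d | d. \<forall>i<n. d i \<in> {-1, 1}}"

definition permutation_mats :: "nat \<Rightarrow> real mat set" where
  "permutation_mats n =
     {Matrix.mat n n (\<lambda>(i, j). if \<pi> i = j then 1 else 0) | \<pi>. \<pi> permutes {..<n}}"

text \<open>The Borel space of real \<open>n \<times> n\<close> matrices, transported from
  \<open>\<real>\<close>-valued families indexed by \<open>{..<n} \<times> {..<n}\<close>.\<close>

definition mat_borel :: "nat \<Rightarrow> real mat measure" where
  "mat_borel n = vimage_algebra (carrier_mat n n)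
     (\<lambda>A. \<lambda>p\<in>{..<n} \<times> {..<n}. A $$ p) (Pi\<^sub>M ({..<n} \<times> {..<n}) (\<lambda>_. borel))"

text \<open>Semi-random with probability 1, with constant \<open>c\<close> (in the role of
  \<open>\<sigma>\<^sub>\<psi>\<^sup>2\<close>). Independence is between the whole sequences \<open>(S\<^sup>(\<^sup>N\<^sup>))\<close> and
  \<open>(\<Psi>\<^sup>(\<^sup>N\<^sup>))\<close>; the signs are required to be i.i.d. for each fixed \<open>N\<close>, and their
  joint law over different \<open>N\<close> is unrestricted.\<close>

definition semi_random_as ::
  "'b measure \<Rightarrow> (nat \<Rightarrow> 'b \<Rightarrow> real mat) \<Rightarrow> real \<Rightarrow> bool" where
  "semi_random_as \<Omega> M c \<longleftrightarrow>
    (\<forall>N. M N \<in> \<Omega> \<rightarrow>\<^sub>M mat_borel N) \<and>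
    (\<exists>(s :: nat \<Rightarrow> nat \<Rightarrow> 'b \<Rightarrow> real) (S :: nat \<Rightarrow> 'b \<Rightarrow> real mat) (\<Psi> :: nat \<Rightarrow> 'b \<Rightarrow> real mat).
      (\<forall>N. prob_space.indep_vars \<Omega> (\<lambda>_. count_space {-1, 1}) (s N) {..<N} \<and>
           (\<forall>i<N. distr \<Omega> (count_space {-1, 1}) (s N i) = uniform_count_measure {-1, 1})) \<and>
      (\<forall>N. \<forall>\<omega>\<in>space \<Omega>. S N \<omega> = mat_diag N (\<lambda>i. s N i \<omega>)) \<and>
      (\<forall>N. \<Psi> N \<in> \<Omega> \<rightarrow>\<^sub>M mat_borel N) \<and>
      prob_space.indep_var \<Omega>
        (Pi\<^sub>M UNIV mat_borel) (\<lambda>\<omega> N. S N \<omega>) (Pi\<^sub>M UNIV mat_borel) (\<lambda>\<omega> N. \<Psi> N \<omega>) \<and>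
      (\<forall>N. \<forall>\<omega>\<in>space \<Omega>. M N \<omega> = S N \<omega> * \<Psi> N \<omega> * S N \<omega>) \<and>
      (AE \<omega> in \<Omega>.
        (\<forall>\<epsilon>>0. (\<lambda>N. max_abs_entry (\<Psi> N \<omega>)) \<in> O(\<lambda>N. real N powr (- 1 / 2 + \<epsilon>))) \<and>
        (\<lambda>N. opnorm_mat (\<Psi> N \<omega>)) \<in> O(\<lambda>N. 1) \<and>
        (\<forall>\<epsilon>>0. (\<lambda>N. max_abs_offdiag (\<Psi> N \<omega> * transpose_mat (\<Psi> N \<omega>)))
                 \<in> O(\<lambda>N. real N powr (- 1 / 2 + \<epsilon>))) \<and>
        (\<lambda>N. max_diag_deviation (\<Psi> N \<omega> * transpose_mat (\<Psi> N \<omega>)) c) \<longlonglongrightarrow> 0))"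

end

theory Submission
  imports Defs
begin

text \<open>Left multiplication of \<open>F\<close> by an independent random sign matrix \<open>S\<close> preserves its law, so
  \<open>\<Psi> = F \<Lambda> F\<^sup>T\<close> gives \<open>S \<Psi> S\<close> with the law of \<open>M\<close>. Up to multiples of the identity, the entries
  of \<open>\<Psi>\<close> and of \<open>\<Psi> \<Psi>\<^sup>T = F \<Lambda>\<^sup>2 F\<^sup>T\<close> are sums \<open>\<Sum>\<^sub>k F\<^sub>i\<^sub>k F\<^sub>j\<^sub>k a\<^sub>k\<close> with a bounded
  centred sequence \<open>a\<close>. By column-permutation invariance, \<open>a\<close> may be permuted uniformly at random
  while \<open>F\<close> is kept fixed; all moments of the resulting sum are bounded by an exchangeable-pair
  recursion, and Markov's inequality with a high moment together with the Borel-Cantelli lemma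
  yields the bound \<open>N\<^sup>-\<^sup>1\<^sup>/\<^sup>2\<^sup>+\<^sup>\<epsilon>\<close> almost surely.\<close>

subsection \<open>Moments of randomly permuted sums\<close>

text \<open>Row signs cannot bound the entries: \<open>D\<close> multiplies the sum for (i, j) by
  the single sign d_i d_j and leaves its modulus unchanged. Only the column permutations supply
  randomness, and the summands stay dependent through the uniform permutation, so exchangeable pairs
  replace a bound for independent sums. The scale is Gaussian: with entries of size about N^(-1/2),
  the weights x_k = F_ik F_jk have sum of squares of order 1/N, and every even moment of the
  permuted sum is at most that of a centred Gaussian of variance 4 A^2 (sum of x_k^2), where A
  bounds |a_k|. A second obstacle is that delocalization holds almost surely with a constant
  depending on the realization, hence gives no rate for the probability of a large entry. The moment
  bound is therefore applied only on the event that all entries are small, which is why that event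
  has to survive column permutations.\<close>

lemma permuted_sum_transpose_diff:
  fixes x a :: "'i \<Rightarrow> real"
  assumes "finite S" "k \<in> S" "l \<in> S"
  shows "(\<Sum>m\<in>S. x m * a (\<pi> m)) - (\<Sum>m\<in>S. x m * a ((\<pi> \<circ> Transposition.transpose k l) m)) =
    (x k - x l) * (a (\<pi> k) - a (\<pi> l))"
proof (cases "k = l")
  case False
  have "(\<Sum>m\<in>S. x m * a (\<pi> m)) - (\<Sum>m\<in>S. x m * a ((\<pi> \<circ> Transposition.transpose k l) m)) =
      (\<Sum>m\<in>S. x m * (a (\<pi> m) - a (\<pi> (Transposition.transpose k l m))))"
    by (simp add: sum_subtractf algebra_simps)
  also have "\<dots> = (\<Sum>m\<in>{k, l}. x m * (a (\<pi> m) - a (\<pi> (Transposition.transpose k l m))))"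
    using assms by (intro sum.mono_neutral_right) (auto simp: transpose_def)
  finally show ?thesis using False by (simp add: algebra_simps)
qed simp

text \<open>Expanding the squares produces a further term -2 (sum of x)^2, which is dropped.\<close>

lemma sum_pairs_diff_sq:
  fixes x :: "'i \<Rightarrow> real"
  shows "(\<Sum>k\<in>S. \<Sum>l\<in>S. (x k - x l)\<^sup>2) \<le> 2 * real (card S) * (\<Sum>k\<in>S. (x k)\<^sup>2)"
proof -
  have "(\<Sum>k\<in>S. \<Sum>l\<in>S. (x k - x l)\<^sup>2) =
      2 * real (card S) * (\<Sum>k\<in>S. (x k)\<^sup>2) - 2 * (\<Sum>k\<in>S. x k)\<^sup>2"
    by (simp add: power2_diff sum.distrib sum_subtractf sum_distrib_left[symmetric]
        sum_distrib_right[symmetric] power2_eq_square algebra_simps)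
      (simp add: sum_distrib_left algebra_simps)
  then show ?thesis by simp
qed

text \<open>Centring \<open>b\<close> kills the product of the two plain sums. With
  \<open>permuted_sum_transpose_diff\<close> this says that the increment, summed over all swaps, is
  a multiple of the permuted sum itself.\<close>

lemma sum_pairs_diff_mult:
  fixes x b :: "'i \<Rightarrow> real"
  assumes "(\<Sum>k\<in>S. b k) = 0"
  shows "(\<Sum>k\<in>S. \<Sum>l\<in>S. (x k - x l) * (b k - b l)) =
    2 * real (card S) * (\<Sum>k\<in>S. x k * b k)"
proof -
  have "(\<Sum>k\<in>S. \<Sum>l\<in>S. (x k - x l) * (b k - b l)) =
      2 * real (card S) * (\<Sum>k\<in>S. x k * b k) - 2 * (\<Sum>k\<in>S. x k) * (\<Sum>k\<in>S. b k)"
    by (simp add: sum.distrib sum_subtractf sum_distrib_left[symmetric]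
        sum_distrib_right[symmetric] algebra_simps)
      (simp add: sum_distrib_left algebra_simps)
  then show ?thesis using assms by simp
qed

text \<open>Factoring out \<open>u - v\<close> leaves 2p+1 monomials of degree 2p, each at most the
  larger of \<open>u ^ (2*p)\<close> and \<open>v ^ (2*p)\<close>. Bounding the maximum by the sum
  keeps the estimate symmetric in \<open>u\<close> and \<open>v\<close>, so that for an exchangeable
  pair both terms give the same moment.\<close>

lemma diff_mult_diff_odd_power_le:
  fixes u v :: real
  shows "(u - v) * (u ^ (2*p+1) - v ^ (2*p+1)) \<le>
    real (2*p+1) * ((u - v)\<^sup>2 * (u ^ (2*p) + v ^ (2*p)))"
proof -
  have bd: "v ^ (2*p - i) * u ^ i \<le> u ^ (2*p) + v ^ (2*p)" if "i \<le> 2*p" for i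
  proof -
    let ?m = "max \<bar>u\<bar> \<bar>v\<bar>"
    have "v ^ (2*p - i) * u ^ i \<le> \<bar>v\<bar> ^ (2*p - i) * \<bar>u\<bar> ^ i"
      by (metis abs_ge_self abs_mult power_abs)
    also have "\<dots> \<le> ?m ^ (2*p - i) * ?m ^ i"
      by (intro mult_mono power_mono) auto
    also have "\<dots> = ?m ^ (2*p)" using that by (simp flip: power_add)
    also have "\<dots> \<le> u ^ (2*p) + v ^ (2*p)"
      by (cases "\<bar>u\<bar> \<le> \<bar>v\<bar>") (auto simp: max_def power_even_abs)
    finally show ?thesis .
  qed
  have "u ^ (2*p+1) - v ^ (2*p+1) = (u - v) * (\<Sum>i<2*p+1. v ^ (2*p - i) * u ^ i)"
    using power_diff_sumr2[of u "2*p+1" v] by simp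
  then have "(u - v) * (u ^ (2*p+1) - v ^ (2*p+1)) =
      (u - v)\<^sup>2 * (\<Sum>i<2*p+1. v ^ (2*p - i) * u ^ i)"
    by (simp add: power2_eq_square)
  also have "\<dots> \<le> (u - v)\<^sup>2 * (\<Sum>i<2*p+1. u ^ (2*p) + v ^ (2*p))"
    by (intro mult_left_mono sum_mono bd) auto
  finally show ?thesis by (simp add: algebra_simps)
qed

text \<open>Exchangeable pairs: replacing \<open>\<pi>\<close> by \<open>\<pi> \<circ> (k l)\<close>
  preserves the uniform law, and averaged over \<open>k, l\<close> it shrinks \<open>T\<close> by the factor
  \<open>1 - 2/n\<close>. Hence \<open>T\<^sup>2\<^sup>p\<^sup>+\<^sup>2\<close> is controlled by \<open>T\<^sup>2\<^sup>p\<close> times the mean squared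
  increment.\<close>

lemma permuted_sum_moment_step:
  fixes x a :: "'i \<Rightarrow> real"
  assumes fin: "finite S" and sum0: "(\<Sum>k\<in>S. a k) = 0" and bd: "\<And>k. k \<in> S \<Longrightarrow> \<bar>a k\<bar> \<le> A"
  defines "T \<equiv> \<lambda>\<pi>. \<Sum>k\<in>S. x k * a (\<pi> k)"
  shows "(\<Sum>\<pi> | \<pi> permutes S. T \<pi> ^ (2 * Suc p)) \<le>
    (4 * real (2*p+1) * (A\<^sup>2 * (\<Sum>k\<in>S. (x k)\<^sup>2))) * (\<Sum>\<pi> | \<pi> permutes S. T \<pi> ^ (2*p))"
proof (cases "S = {}")
  case True
  then show ?thesis by (simp add: T_def)
next
  case False
  let ?P = "{\<pi>. \<pi> permutes S}"
  let ?n = "real (card S)"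
  define V where "V = (\<Sum>k\<in>S. (x k)\<^sup>2)"
  have npos: "?n > 0" using False fin by (simp add: card_gt_0_iff)
  have diff: "T \<pi> - T (\<pi> \<circ> Transposition.transpose k l) = (x k - x l) * (a (\<pi> k) - a (\<pi> l))"
    if "k \<in> S" "l \<in> S" for \<pi> k l
    unfolding T_def by (rule permuted_sum_transpose_diff[OF fin that])
  have exch: "(\<Sum>\<pi>\<in>?P. (T \<pi> - T (\<pi> \<circ> Transposition.transpose k l)) * T \<pi> ^ (2*p+1)) \<le>
      real (2*p+1) * (\<Sum>\<pi>\<in>?P. (T \<pi> - T (\<pi> \<circ> Transposition.transpose k l))\<^sup>2 * T \<pi> ^ (2*p))"
    if "k \<in> S" "l \<in> S" for k l
  proof -
    let ?q = "\<lambda>\<pi>. \<pi> \<circ> Transposition.transpose k l"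
    have q: "Transposition.transpose k l permutes S" using that by (rule permutes_swap_id)
    have qq: "?q (?q \<pi>) = \<pi>" for \<pi> by (simp add: comp_assoc)
    \<comment> \<open>\<open>?q\<close> is an involution on the permutations, so the two members of
      the pair may trade places under the sum. Adding the sum to its mirrored copy then creates the
      product of differences of \<open>diff_mult_diff_odd_power_le\<close>.\<close>
    have r: "(\<Sum>\<pi>\<in>?P. f \<pi> (?q \<pi>)) = (\<Sum>\<pi>\<in>?P. f (?q \<pi>) \<pi>)" for f :: "('i\<Rightarrow>'i) \<Rightarrow> ('i\<Rightarrow>'i) \<Rightarrow> real"
      using sum_permutations_compose_right[OF q, of "\<lambda>\<pi>. f \<pi> (?q \<pi>)"] by (simp add: qq)
    have "2 * (\<Sum>\<pi>\<in>?P. (T \<pi> - T (?q \<pi>)) * T \<pi> ^ (2*p+1)) =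
        (\<Sum>\<pi>\<in>?P. (T \<pi> - T (?q \<pi>)) * T \<pi> ^ (2*p+1)) + (\<Sum>\<pi>\<in>?P. (T (?q \<pi>) - T \<pi>) * T (?q \<pi>) ^ (2*p+1))"
      using r[of "\<lambda>\<pi> \<rho>. (T \<pi> - T \<rho>) * T \<pi> ^ (2*p+1)"] by simp
    also have "\<dots> = (\<Sum>\<pi>\<in>?P. (T \<pi> - T (?q \<pi>)) * (T \<pi> ^ (2*p+1) - T (?q \<pi>) ^ (2*p+1)))"
      unfolding sum.distrib[symmetric] by (intro sum.cong) (auto simp: algebra_simps)
    also have "\<dots> \<le> (\<Sum>\<pi>\<in>?P. real (2*p+1) *
        ((T \<pi> - T (?q \<pi>))\<^sup>2 * (T \<pi> ^ (2*p) + T (?q \<pi>) ^ (2*p))))"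
      by (intro sum_mono diff_mult_diff_odd_power_le)
    also have "\<dots> = real (2*p+1) * ((\<Sum>\<pi>\<in>?P. (T \<pi> - T (?q \<pi>))\<^sup>2 * T \<pi> ^ (2*p)) +
        (\<Sum>\<pi>\<in>?P. (T (?q \<pi>) - T \<pi>)\<^sup>2 * T (?q \<pi>) ^ (2*p)))"
      unfolding sum_distrib_left[symmetric] sum.distrib[symmetric]
      by (intro arg_cong2[where f="(*)"] sum.cong) (auto simp: algebra_simps power2_commute)
    also have "\<dots> = 2 * (real (2*p+1) * (\<Sum>\<pi>\<in>?P. (T \<pi> - T (?q \<pi>))\<^sup>2 * T \<pi> ^ (2*p)))"
      using r[of "\<lambda>\<pi> \<rho>. (T \<pi> - T \<rho>)\<^sup>2 * T \<pi> ^ (2*p)"] by simp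
    finally show ?thesis by simp
  qed
  have sq: "(\<Sum>k\<in>S. \<Sum>l\<in>S. (T \<pi> - T (\<pi> \<circ> Transposition.transpose k l))\<^sup>2) \<le> 8 * A\<^sup>2 * ?n * V"
    if "\<pi> \<in> ?P" for \<pi>
  proof -
    have "(\<Sum>k\<in>S. \<Sum>l\<in>S. (T \<pi> - T (\<pi> \<circ> Transposition.transpose k l))\<^sup>2) \<le>
        (\<Sum>k\<in>S. \<Sum>l\<in>S. (x k - x l)\<^sup>2 * (2 * A)\<^sup>2)"
    proof (intro sum_mono)
      fix k l assume kl: "k \<in> S" "l \<in> S"
      then have "\<pi> k \<in> S" "\<pi> l \<in> S" using that by (auto simp: permutes_in_image)
      then have "\<bar>a (\<pi> k)\<bar> \<le> A" "\<bar>a (\<pi> l)\<bar> \<le> A" by (auto intro: bd)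
      then have "\<bar>a (\<pi> k) - a (\<pi> l)\<bar> \<le> \<bar>2 * A\<bar>" by linarith
      then have "(a (\<pi> k) - a (\<pi> l))\<^sup>2 \<le> (2 * A)\<^sup>2" by (rule abs_le_square_iff[THEN iffD1])
      then show "(T \<pi> - T (\<pi> \<circ> Transposition.transpose k l))\<^sup>2 \<le> (x k - x l)\<^sup>2 * (2 * A)\<^sup>2"
        using diff[OF kl] by (simp add: power_mult_distrib mult_left_mono)
    qed
    also have "\<dots> = (2*A)\<^sup>2 * (\<Sum>k\<in>S. \<Sum>l\<in>S. (x k - x l)\<^sup>2)"
      by (simp add: sum_distrib_left mult.commute)
    also have "\<dots> \<le> (2*A)\<^sup>2 * (2 * ?n * V)"
      unfolding V_def by (intro mult_left_mono sum_pairs_diff_sq) auto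
    finally show ?thesis by (simp add: power2_eq_square algebra_simps)
  qed
  have drift: "(\<Sum>k\<in>S. \<Sum>l\<in>S. T \<pi> - T (\<pi> \<circ> Transposition.transpose k l)) = 2 * ?n * T \<pi>" if "\<pi> \<in> ?P" for \<pi>
  proof -
    have "(\<Sum>k\<in>S. a (\<pi> k)) = 0"
      using sum0 that sum.permute[of \<pi> S a] by (simp add: comp_def)
    have "(\<Sum>k\<in>S. \<Sum>l\<in>S. T \<pi> - T (\<pi> \<circ> Transposition.transpose k l)) =
        (\<Sum>k\<in>S. \<Sum>l\<in>S. (x k - x l) * (a (\<pi> k) - a (\<pi> l)))"
      by (intro sum.cong refl diff)
    also have "\<dots> = 2 * ?n * T \<pi>"
      unfolding T_def by (rule sum_pairs_diff_mult) fact
    finally show ?thesis .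
  qed
  \<comment> \<open>One factor \<open>T \<pi>\<close> of the even power is replaced through
    \<open>drift\<close>; \<open>exch\<close> trades the remaining odd power for squared increments,
    which \<open>sq\<close> bounds. The constant 4 is the quotient of 8 n from \<open>sq\<close> by
    2 n from \<open>drift\<close>.\<close>
  have "2 * ?n * (\<Sum>\<pi>\<in>?P. T \<pi> ^ (2 * Suc p)) =
      (\<Sum>\<pi>\<in>?P. (\<Sum>k\<in>S. \<Sum>l\<in>S. T \<pi> - T (\<pi> \<circ> Transposition.transpose k l)) * T \<pi> ^ (2*p+1))"
    unfolding sum_distrib_left by (intro sum.cong) (auto simp: drift)
  also have "\<dots> = (\<Sum>k\<in>S. \<Sum>l\<in>S. \<Sum>\<pi>\<in>?P. (T \<pi> - T (\<pi> \<circ> Transposition.transpose k l)) * T \<pi> ^ (2*p+1))"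
    unfolding sum_distrib_right
    by (subst sum.swap, intro sum.cong refl, subst sum.swap) simp
  also have "\<dots> \<le> (\<Sum>k\<in>S. \<Sum>l\<in>S. real (2*p+1) *
      (\<Sum>\<pi>\<in>?P. (T \<pi> - T (\<pi> \<circ> Transposition.transpose k l))\<^sup>2 * T \<pi> ^ (2*p)))"
    by (intro sum_mono exch)
  also have "\<dots> = real (2*p+1) *
      (\<Sum>k\<in>S. \<Sum>l\<in>S. \<Sum>\<pi>\<in>?P. (T \<pi> - T (\<pi> \<circ> Transposition.transpose k l))\<^sup>2 * T \<pi> ^ (2*p))"
    by (simp only: sum_distrib_left)
  also have "(\<Sum>k\<in>S. \<Sum>l\<in>S. \<Sum>\<pi>\<in>?P. (T \<pi> - T (\<pi> \<circ> Transposition.transpose k l))\<^sup>2 * T \<pi> ^ (2*p)) =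
      (\<Sum>\<pi>\<in>?P. (\<Sum>k\<in>S. \<Sum>l\<in>S. (T \<pi> - T (\<pi> \<circ> Transposition.transpose k l))\<^sup>2) * T \<pi> ^ (2*p))"
    unfolding sum_distrib_right
    by (subst (2) sum.swap, intro sum.cong refl, subst sum.swap) simp
  also have "\<dots> \<le> (\<Sum>\<pi>\<in>?P. (8 * A\<^sup>2 * ?n * V) * T \<pi> ^ (2*p))"
    by (intro sum_mono mult_right_mono sq) auto
  finally have "2 * ?n * (\<Sum>\<pi>\<in>?P. T \<pi> ^ (2 * Suc p)) \<le>
      real (2*p+1) * (\<Sum>\<pi>\<in>?P. (8 * A\<^sup>2 * ?n * V) * T \<pi> ^ (2*p))"
    by (simp add: mult_left_mono)
  also have "\<dots> = 2 * ?n * ((4 * real (2*p+1) * (A\<^sup>2 * V)) * (\<Sum>\<pi>\<in>?P. T \<pi> ^ (2*p)))"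
    by (simp add: sum_distrib_left[symmetric] algebra_simps)
  finally show ?thesis using npos unfolding V_def by (simp add: mult_le_cancel_left_pos)
qed

text \<open>Iteration of the recursion; the factorial is the zeroth moment, the number of
  permutations. The product equals 4^p (2p-1)!!, whence the Gaussian form of the bound.\<close>

lemma permuted_sum_moment:
  fixes x a :: "'i \<Rightarrow> real"
  assumes "finite S" "(\<Sum>k\<in>S. a k) = 0" "\<And>k. k \<in> S \<Longrightarrow> \<bar>a k\<bar> \<le> A"
  shows "(\<Sum>\<pi> | \<pi> permutes S. (\<Sum>k\<in>S. x k * a (\<pi> k)) ^ (2*p)) \<le>
    fact (card S) * ((\<Prod>q<p. 4 * real (2*q+1)) * (A\<^sup>2 * (\<Sum>k\<in>S. (x k)\<^sup>2)) ^ p)"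
proof (induction p)
  case 0
  then show ?case using assms(1) by (simp add: card_permutations)
next
  case (Suc p)
  have "0 \<le> 4 * real (2*p+1) * (A\<^sup>2 * (\<Sum>k\<in>S. (x k)\<^sup>2))" by (simp add: sum_nonneg)
  from order_trans[OF permuted_sum_moment_step[OF assms] mult_left_mono[OF Suc.IH this]]
  show ?case by (simp add: algebra_simps)
qed

subsection \<open>Column-permutation invariant random matrices\<close>

lemma space_mat_borel [simp]: "space (mat_borel n) = carrier_mat n n"
  by (simp add: mat_borel_def)

lemma measurable_mat_borel_entry [measurable]:
  assumes "i < n" "j < n"
  shows "(\<lambda>A. A $$ (i, j)) \<in> borel_measurable (mat_borel n)"
proof -
  let ?I = "{..<n} \<times> {..<n}"
  have "(\<lambda>A. \<lambda>p\<in>?I. A $$ p) \<in> mat_borel n \<rightarrow>\<^sub>M Pi\<^sub>M ?I (\<lambda>_. borel)"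
    unfolding mat_borel_def by (rule measurable_vimage_algebra1) (auto simp: space_PiM)
  then have "(\<lambda>A. (\<lambda>p\<in>?I. A $$ p) (i, j)) \<in> borel_measurable (mat_borel n)"
    by (rule measurable_compose[OF _ measurable_component_singleton]) (use assms in auto)
  then show ?thesis using assms by simp
qed

lemma measurable_mat_borelI:
  assumes "\<And>x. x \<in> space M \<Longrightarrow> f x \<in> carrier_mat n n"
    and "\<And>i j. i < n \<Longrightarrow> j < n \<Longrightarrow> (\<lambda>x. f x $$ (i, j)) \<in> borel_measurable M"
  shows "f \<in> M \<rightarrow>\<^sub>M mat_borel n"
  unfolding mat_borel_def
proof (rule measurable_vimage_algebra2)
  show "(\<lambda>x. \<lambda>p\<in>{..<n} \<times> {..<n}. f x $$ p) \<in> M \<rightarrow>\<^sub>M Pi\<^sub>M ({..<n} \<times> {..<n}) (\<lambda>_. borel)"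
    by (rule measurable_restrict) (use assms(2) in auto)
qed (use assms(1) in auto)

lemma diag_conj_index:
  fixes A :: "real mat"
  assumes "A \<in> carrier_mat n n" "i < n" "j < n"
  shows "(A * mat_diag n d * transpose_mat A) $$ (i, j) = (\<Sum>k<n. A $$ (i, k) * A $$ (j, k) * d k)"
  using assms
  by (subst mat_diag_mult_right[of _ n])
    (auto simp: scalar_prod_def lessThan_atLeast0 intro!: sum.cong)

lemma diag_conj_carrier [simp]:
  fixes A :: "real mat"
  shows "A \<in> carrier_mat n n \<Longrightarrow> A * mat_diag n d * transpose_mat A \<in> carrier_mat n n"
  by auto

definition perm_mat :: "nat \<Rightarrow> (nat \<Rightarrow> nat) \<Rightarrow> real mat" where
  "perm_mat n \<pi> = Matrix.mat n n (\<lambda>(i, j). if \<pi> i = j then 1 else 0)"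

text \<open>Column \<open>k\<close> moves to position \<open>\<pi> k\<close>. Reading the product at
  \<open>\<pi> k\<close> avoids the inverse permutation.\<close>

lemma mult_perm_mat_index:
  assumes "A \<in> carrier_mat n n" "\<pi> permutes {..<n}" "i < n" "k < n"
  shows "(A * perm_mat n \<pi>) $$ (i, \<pi> k) = A $$ (i, k)"
proof -
  have \<pi>k: "\<pi> k < n" using assms permutes_in_image[of \<pi> "{..<n}" k] by simp
  have "(A * perm_mat n \<pi>) $$ (i, \<pi> k) = (\<Sum>m<n. A $$ (i, m) * (if \<pi> m = \<pi> k then 1 else 0))"
    using assms(1,3) \<pi>k
    by (auto simp: perm_mat_def scalar_prod_def lessThan_atLeast0 intro!: sum.cong)
  also have "\<dots> = (\<Sum>m<n. if m = k then A $$ (i, m) else 0)"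
    using permutes_inj[OF assms(2)] by (intro sum.cong) (auto dest: injD)
  finally show ?thesis using assms(4) by simp
qed

text \<open>Reindexing by \<open>\<pi>\<close> shifts the permutation from the columns to the
  coefficients. With the matrix frozen, averaging over \<open>\<pi>\<close> is then covered by
  \<open>permuted_sum_moment\<close>.\<close>

lemma gram_form_mult_perm_mat:
  fixes a :: "nat \<Rightarrow> real"
  assumes "A \<in> carrier_mat n n" "\<pi> permutes {..<n}" "i < n" "j < n"
  shows "(\<Sum>k<n. (A * perm_mat n \<pi>) $$ (i, k) * (A * perm_mat n \<pi>) $$ (j, k) * a k) =
    (\<Sum>k<n. A $$ (i, k) * A $$ (j, k) * a (\<pi> k))"
  by (subst sum.permute[OF assms(2)]) (use assms in \<open>simp add: mult_perm_mat_index\<close>)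

text \<open>Permuting columns only rearranges the entries. Consequently a realization with one large
  entry lies in none of the permuted events.\<close>

lemma entries_bounded_mult_perm_mat:
  assumes "A \<in> carrier_mat n n" "\<pi> permutes {..<n}"
  assumes bd: "\<forall>i<n. \<forall>k<n. \<bar>(A * perm_mat n \<pi>) $$ (i, k)\<bar> \<le> \<delta>"
  shows "\<forall>i<n. \<forall>k<n. \<bar>A $$ (i, k)\<bar> \<le> \<delta>"
proof (intro allI impI)
  fix i k assume ik: "i < n" "k < n"
  then have "\<pi> k < n" using assms(2) permutes_in_image[of \<pi> "{..<n}" k] by simp
  then have "\<bar>(A * perm_mat n \<pi>) $$ (i, \<pi> k)\<bar> \<le> \<delta>" using bd ik by blast
  then show "\<bar>A $$ (i, k)\<bar> \<le> \<delta>" using mult_perm_mat_index[OF assms(1,2) ik] by simp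
qed

text \<open>The law of \<open>F\<close> does not change when its columns are permuted uniformly at random, and the
  event that all entries are bounded by \<open>\<delta>\<close> is invariant. So the probability is at most the
  supremum, over fixed matrices with such entries, of the probability over the permutation.\<close>

lemma gram_form_deviation:
  fixes F :: "'a \<Rightarrow> real mat" and a :: "nat \<Rightarrow> real"
  assumes "prob_space \<Omega>" and F: "F \<in> \<Omega> \<rightarrow>\<^sub>M mat_borel n"
    and inv: "\<And>\<pi>. \<pi> permutes {..<n} \<Longrightarrow>
      distr \<Omega> (mat_borel n) (\<lambda>\<omega>. F \<omega> * perm_mat n \<pi>) = distr \<Omega> (mat_borel n) F"
    and sum0: "(\<Sum>k<n. a k) = 0" and bd: "\<And>k. k < n \<Longrightarrow> \<bar>a k\<bar> \<le> A"
    and ij: "i < n" "j < n" and t: "t > 0"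
  shows "measure \<Omega> {\<omega> \<in> space \<Omega>. (\<forall>i<n. \<forall>k<n. \<bar>F \<omega> $$ (i, k)\<bar> \<le> \<delta>) \<and>
      t \<le> \<bar>\<Sum>k<n. F \<omega> $$ (i, k) * F \<omega> $$ (j, k) * a k\<bar>} \<le>
    (\<Prod>q<p. 4 * real (2*q+1)) * (A\<^sup>2 * (real n * \<delta> ^ 4)) ^ p / t ^ (2*p)"
    (is "?m \<le> ?q")
proof -
  interpret prob_space \<Omega> by fact
  let ?P = "{\<pi>. \<pi> permutes {..<n}}"
  \<comment> \<open>A set of matrices rather than of outcomes: every \<open>E \<pi>\<close> and the
    target event are preimages of \<open>H\<close>, so equality of laws gives them equal
    probabilities.\<close>
  define H where "H = {X \<in> space (mat_borel n). (\<forall>i\<in>{..<n}. \<forall>k\<in>{..<n}. \<bar>X $$ (i, k)\<bar> \<le> \<delta>) \<and>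
      t \<le> \<bar>\<Sum>k\<in>{..<n}. X $$ (i, k) * X $$ (j, k) * a k\<bar>}"
  have H: "H \<in> sets (mat_borel n)"
    unfolding H_def using ij
    by (intro sets.sets_Collect_conj sets.sets_Collect_finite_All borel_measurable_le
        borel_measurable_abs borel_measurable_sum borel_measurable_times borel_measurable_const
        measurable_mat_borel_entry) auto
  have FC: "F \<omega> \<in> carrier_mat n n" if "\<omega> \<in> space \<Omega>" for \<omega>
    using measurable_space[OF F that] by simp
  have FP [measurable]: "(\<lambda>\<omega>. F \<omega> * perm_mat n \<pi>) \<in> \<Omega> \<rightarrow>\<^sub>M mat_borel n" if \<pi>: "\<pi> \<in> ?P" for \<pi>
  proof (rule measurable_mat_borelI)
    fix i j assume ij': "i < n" "j < n"
    let ?k = "Hilbert_Choice.inv \<pi> j"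
    have k: "?k < n" "\<pi> ?k = j"
      using \<pi> ij' permutes_in_image[OF permutes_inv, of \<pi> "{..<n}" j] permutes_inverses[of \<pi> "{..<n}"]
      by auto
    have "(\<lambda>\<omega>. F \<omega> $$ (i, ?k)) \<in> borel_measurable \<Omega>"
      using measurable_compose[OF F measurable_mat_borel_entry[OF ij'(1) k(1)]] .
    then show "(\<lambda>\<omega>. (F \<omega> * perm_mat n \<pi>) $$ (i, j)) \<in> borel_measurable \<Omega>"
      by (rule measurable_cong[THEN iffD1, rotated])
        (use mult_perm_mat_index[OF FC _ ij'(1) k(1), of _ \<pi>] \<pi> k(2) in simp)
  qed (use FC in \<open>auto simp: perm_mat_def intro!: mult_carrier_mat\<close>)
  define E where "E \<pi> = {\<omega> \<in> space \<Omega>. F \<omega> * perm_mat n \<pi> \<in> H}" for \<pi>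
  have E [measurable]: "E \<pi> \<in> sets \<Omega>" if "\<pi> \<in> ?P" for \<pi>
    unfolding E_def using measurable_sets[OF FP[OF that] H] by (simp add: vimage_def Int_def conj_commute)
  have m: "measure \<Omega> (E \<pi>) = ?m" if "\<pi> \<in> ?P" for \<pi>
  proof -
    have "measure \<Omega> (E \<pi>) = measure (distr \<Omega> (mat_borel n) (\<lambda>\<omega>. F \<omega> * perm_mat n \<pi>)) H"
      unfolding E_def by (subst measure_distr[OF FP[OF that] H]) (auto intro!: arg_cong2[where f=measure])
    also have "\<dots> = measure (distr \<Omega> (mat_borel n) F) H" using inv that by simp
    also have "\<dots> = ?m"
      by (subst measure_distr[OF F H]) (auto simp: H_def FC intro!: arg_cong2[where f=measure])
    finally show ?thesis .
  qed
  have qnn: "0 \<le> ?q" using t by (intro divide_nonneg_nonneg mult_nonneg_nonneg prod_nonneg) auto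
  \<comment> \<open>For fixed \<open>\<omega>\<close> the sum counts the permutations that bring the
    matrix into \<open>H\<close>, and Markov's inequality with exponent 2p bounds this
    count.\<close>
  have pointwise: "(\<Sum>\<pi>\<in>?P. indicat_real (E \<pi>) \<omega>) \<le> fact n * ?q" if \<omega>: "\<omega> \<in> space \<Omega>" for \<omega>
  proof (cases "\<forall>i<n. \<forall>k<n. \<bar>F \<omega> $$ (i, k)\<bar> \<le> \<delta>")
    case False
    then have "\<omega> \<notin> E \<pi>" if "\<pi> \<in> ?P" for \<pi>
      using entries_bounded_mult_perm_mat[OF FC[OF \<omega>], of \<pi> \<delta>] that
      by (force simp: E_def H_def)
    then have "(\<Sum>\<pi>\<in>?P. indicat_real (E \<pi>) \<omega>) = 0" by simp
    then show ?thesis using mult_nonneg_nonneg[OF _ qnn, of "fact n"] by simp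
  next
    case True
    define x where "x k = F \<omega> $$ (i, k) * F \<omega> $$ (j, k)" for k
    define T where "T \<pi> = (\<Sum>k<n. x k * a (\<pi> k))" for \<pi>
    have "(\<Sum>k<n. (x k)\<^sup>2) \<le> (\<Sum>k<n. \<delta> ^ 4)"
    proof (intro sum_mono)
      fix k assume "k \<in> {..<n}"
      then have "\<bar>F \<omega> $$ (i, k)\<bar> \<le> \<delta>" "\<bar>F \<omega> $$ (j, k)\<bar> \<le> \<delta>" using True ij by auto
      then have "\<bar>F \<omega> $$ (i, k)\<bar> * \<bar>F \<omega> $$ (j, k)\<bar> \<le> \<delta> * \<delta>" by (intro mult_mono) auto
      then have "\<bar>x k\<bar> \<le> \<bar>\<delta> * \<delta>\<bar>" by (simp add: x_def abs_mult)
      then have "(x k)\<^sup>2 \<le> (\<delta> * \<delta>)\<^sup>2" by (rule abs_le_square_iff[THEN iffD1])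
      then show "(x k)\<^sup>2 \<le> \<delta> ^ 4" by (simp add: power2_eq_square power4_eq_xxxx mult.assoc)
    qed
    then have V: "(\<Sum>k<n. (x k)\<^sup>2) \<le> real n * \<delta> ^ 4" by simp
    have "(\<Sum>\<pi>\<in>?P. indicat_real (E \<pi>) \<omega>) \<le> (\<Sum>\<pi>\<in>?P. T \<pi> ^ (2*p) / t ^ (2*p))"
    proof (intro sum_mono)
      fix \<pi> assume \<pi>: "\<pi> \<in> ?P"
      have "1 \<le> T \<pi> ^ (2*p) / t ^ (2*p)" if "\<omega> \<in> E \<pi>"
      proof -
        have "t \<le> \<bar>T \<pi>\<bar>"
          using that gram_form_mult_perm_mat[OF FC[OF \<omega>] _ ij, of \<pi> a] \<pi>
          by (auto simp: E_def H_def T_def x_def)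
        then have "t ^ (2*p) \<le> \<bar>T \<pi>\<bar> ^ (2*p)" using t by (intro power_mono) auto
        then show ?thesis using t by (simp add: power_even_abs)
      qed
      then show "indicat_real (E \<pi>) \<omega> \<le> T \<pi> ^ (2*p) / t ^ (2*p)"
        by (auto simp: indicator_def)
    qed
    also have "\<dots> = (\<Sum>\<pi>\<in>?P. T \<pi> ^ (2*p)) / t ^ (2*p)" by (simp add: sum_divide_distrib)
    also have "\<dots> \<le> (fact n * ((\<Prod>q<p. 4 * real (2*q+1)) * (A\<^sup>2 * (\<Sum>k<n. (x k)\<^sup>2)) ^ p)) / t ^ (2*p)"
      using permuted_sum_moment[of "{..<n}" a A x p] sum0 bd t
      by (intro divide_right_mono) (auto simp: T_def)
    also have "\<dots> \<le> (fact n * ((\<Prod>q<p. 4 * real (2*q+1)) * (A\<^sup>2 * (real n * \<delta> ^ 4)) ^ p)) / t ^ (2*p)"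
      using t V by (intro divide_right_mono mult_left_mono power_mono)
        (auto intro!: prod_nonneg mult_nonneg_nonneg sum_nonneg)
    finally show ?thesis by simp
  qed
  \<comment> \<open>All n! events have the probability \<open>?m\<close>; exchanging sum and
    integral replaces their total by the pointwise count.\<close>
  have "fact n * ?m = (\<Sum>\<pi>\<in>?P. measure \<Omega> (E \<pi>))"
    by (simp add: m card_permutations)
  also have "\<dots> = (\<Sum>\<pi>\<in>?P. (\<integral>\<omega>. indicat_real (E \<pi>) \<omega> \<partial>\<Omega>))"
    using E by (intro sum.cong) auto
  also have "\<dots> = (\<integral>\<omega>. (\<Sum>\<pi>\<in>?P. indicat_real (E \<pi>) \<omega>) \<partial>\<Omega>)"
    using E by (subst Bochner_Integration.integral_sum) (auto simp: less_top[symmetric])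
  also have "\<dots> \<le> (\<integral>\<omega>. fact n * ?q \<partial>\<Omega>)"
    using E pointwise by (intro integral_mono) (auto simp: less_top[symmetric])
  also have "\<dots> = fact n * ?q" by (simp add: prob_space)
  finally show ?thesis by (rule mult_left_le_imp_le) (rule fact_gt_zero)
qed

section \<open>Almost sure bounds by Borel-Cantelli\<close>

lemma bigo_powr_imp_le_powr:
  fixes f :: "nat \<Rightarrow> real"
  assumes "f \<in> O(\<lambda>N. real N powr \<alpha>)" "\<alpha> < \<beta>"
  shows "\<forall>\<^sub>F N in sequentially. \<bar>f N\<bar> \<le> real N powr \<beta>"
proof -
  \<comment> \<open>The gap between the exponents swallows the unknown constant of the big-O
    bound.\<close>
  have "(\<lambda>N. real N powr \<alpha>) \<in> o(\<lambda>N. real N powr \<beta>)"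
    using assms(2) powr_smallo_iff[OF filterlim_real_sequentially] by simp
  with assms(1) have "f \<in> o(\<lambda>N. real N powr \<beta>)" by (rule landau_o.big_small_trans)
  from landau_o.smallD[OF this, of 1] show ?thesis by simp
qed

lemma abs_entry_le_max_abs_entry:
  assumes "A \<in> carrier_mat n m" "i < n" "j < m"
  shows "\<bar>A $$ (i, j)\<bar> \<le> max_abs_entry A"
  unfolding max_abs_entry_def using assms by (intro Max_ge) (auto intro!: image_eqI[of _ _ "(i, j)"])

text \<open>The bad events \<open>E\<close> contain the requirement of small entries, so their
  probabilities are summable without any rate for delocalization. Delocalization enters only
  afterwards, for a fixed realization: eventually the entries are below \<open>\<delta> N\<close>,
  and avoiding \<open>E\<close> then forces the sum to be small.\<close>

lemma gram_form_AE_small: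
  fixes F :: "nat \<Rightarrow> 'a \<Rightarrow> real mat" and a :: "nat \<Rightarrow> nat \<Rightarrow> real"
  assumes "prob_space \<Omega>" and F: "\<And>N. F N \<in> \<Omega> \<rightarrow>\<^sub>M mat_borel N"
    and inv: "\<And>N \<pi>. \<pi> permutes {..<N} \<Longrightarrow>
      distr \<Omega> (mat_borel N) (\<lambda>\<omega>. F N \<omega> * perm_mat N \<pi>) = distr \<Omega> (mat_borel N) (F N)"
    and deloc: "AE \<omega> in \<Omega>. \<forall>\<epsilon>>0. (\<lambda>N. max_abs_entry (F N \<omega>)) \<in> O(\<lambda>N. real N powr (- 1 / 2 + \<epsilon>))"
    and sum0: "\<And>N. (\<Sum>k<N. a N k) = 0"
    and bd: "\<forall>\<^sub>F N in sequentially. \<forall>k<N. \<bar>a N k\<bar> \<le> A"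
    and \<epsilon>: "\<epsilon> > 0"
  shows "AE \<omega> in \<Omega>. \<forall>\<^sub>F N in sequentially. \<forall>i<N. \<forall>j<N.
    \<bar>\<Sum>k<N. F N \<omega> $$ (i, k) * F N \<omega> $$ (j, k) * a N k\<bar> \<le> real N powr (- 1 / 2 + \<epsilon>)"
proof -
  interpret prob_space \<Omega> by fact
  \<comment> \<open>With these exponents, N \<delta>^4 / t^2 = N^(-\<epsilon>), so the moment of
    order 2p gives N^(-\<epsilon> p). Taking p \<ge> 4/\<epsilon> makes this at most N^(-4); the
    union over N^2 index pairs leaves the summable N^(-2).\<close>
  define \<delta> where "\<delta> N = real N powr (- 1 / 2 + \<epsilon> / 4)" for N
  define t where "t N = real N powr (- 1 / 2 + \<epsilon>)" for N
  define p where "p = nat \<lceil>4 / \<epsilon>\<rceil>"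
  define C where "C = (\<Prod>q<p. 4 * real (2*q+1)) * (A\<^sup>2) ^ p"
  define E where "E N i j = {\<omega> \<in> space \<Omega>. (\<forall>i<N. \<forall>k<N. \<bar>F N \<omega> $$ (i, k)\<bar> \<le> \<delta> N) \<and>
      t N \<le> \<bar>\<Sum>k<N. F N \<omega> $$ (i, k) * F N \<omega> $$ (j, k) * a N k\<bar>}" for N i j
  define B where "B N = (\<Union>i\<in>{..<N}. \<Union>j\<in>{..<N}. E N i j)" for N
  have FC: "F N \<omega> \<in> carrier_mat N N" if "\<omega> \<in> space \<Omega>" for N \<omega>
    using measurable_space[OF F that] by simp
  have E: "E N i j \<in> sets \<Omega>" if "i < N" "j < N" for N i j
    unfolding E_def Ball_def[of "{..<N}", simplified, symmetric] using that
    by (intro sets.sets_Collect_conj sets.sets_Collect_finite_All borel_measurable_le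
        borel_measurable_abs borel_measurable_sum borel_measurable_times borel_measurable_const
        measurable_compose[OF F measurable_mat_borel_entry]) auto
  have B: "B N \<in> sets \<Omega>" for N
    unfolding B_def using E by (intro sets.finite_UN) auto
  have p: "4 \<le> \<epsilon> * real p"
  proof -
    have "4 / \<epsilon> \<le> real p" unfolding p_def by linarith
    then show ?thesis using \<epsilon> by (simp add: field_simps)
  qed
  have E_le: "measure \<Omega> (E N i j) \<le> C * real N powr (- 4)"
    if N: "N > 0" and bdN: "\<forall>k<N. \<bar>a N k\<bar> \<le> A" and ij: "i < N" "j < N" for N i j
  proof -
    have t: "t N > 0" using N by (simp add: t_def)
    have "real N * \<delta> N ^ 4 / (t N)\<^sup>2 = real N powr 1 * real N powr (-2 + \<epsilon>) / real N powr (-1 + 2 * \<epsilon>)"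
      using N by (simp add: \<delta>_def t_def powr_power)
    also have "\<dots> = real N powr (- \<epsilon>)"
      by (subst powr_add[symmetric], subst powr_diff[symmetric]) simp
    finally have r: "real N * \<delta> N ^ 4 / (t N)\<^sup>2 = real N powr (- \<epsilon>)" .
    have "measure \<Omega> (E N i j) \<le>
        (\<Prod>q<p. 4 * real (2*q+1)) * (A\<^sup>2 * (real N * \<delta> N ^ 4)) ^ p / t N ^ (2*p)"
      unfolding E_def using inv bdN
      by (intro gram_form_deviation F sum0 ij t) (auto intro: prob_space_axioms)
    also have "\<dots> = C * (real N * \<delta> N ^ 4 / (t N)\<^sup>2) ^ p"
      by (simp add: C_def power_mult_distrib power_divide power_mult)
    also have "\<dots> = C * real N powr (- (\<epsilon> * real p))"
      using N by (simp add: r powr_power mult.commute)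
    also have "\<dots> \<le> C * real N powr (- 4)"
      using N p by (intro mult_left_mono powr_mono) (auto simp: C_def intro!: mult_nonneg_nonneg prod_nonneg)
    finally show ?thesis .
  qed
  have B_le: "\<forall>\<^sub>F N in sequentially. norm (measure \<Omega> (B N)) \<le> C * real N powr (- 2)"
    using bd eventually_gt_at_top[of 0]
  proof eventually_elim
    case (elim N)
    have "measure \<Omega> (B N) \<le> (\<Sum>i<N. measure \<Omega> (\<Union>j\<in>{..<N}. E N i j))"
      unfolding B_def using E by (intro measure_UNION_le sets.finite_UN) auto
    also have "\<dots> \<le> (\<Sum>i<N. \<Sum>j<N. measure \<Omega> (E N i j))"
      using E by (intro sum_mono measure_UNION_le) auto
    also have "\<dots> \<le> (\<Sum>i<N. \<Sum>j<N. C * real N powr (- 4))"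
      using E_le elim by (intro sum_mono) auto
    also have "\<dots> = C * (real N powr 2 * real N powr (- 4))"
      using elim by (simp add: powr_numeral power2_eq_square)
    also have "real N powr 2 * real N powr (- 4) = real N powr (- 2)"
      by (subst powr_add[symmetric]) simp
    finally show ?case by simp
  qed
  have "summable (\<lambda>N. C * real N powr (- 2))"
    by (intro summable_mult) (simp add: summable_real_powr_iff)
  with B_le have "summable (\<lambda>N. measure \<Omega> (B N))" by (rule summable_comparison_test_ev)
  then have "AE \<omega> in \<Omega>. \<forall>\<^sub>F N in sequentially. \<omega> \<in> space \<Omega> - B N"
    using B by (intro borel_cantelli_AE1) (auto simp: less_top[symmetric])
  with deloc AE_space show ?thesis
  proof eventually_elim
    case (elim \<omega>)
    \<comment> \<open>Strictly below the \<epsilon>/4 in \<open>\<delta>\<close>, which leaves room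
      to absorb the realization-dependent constant.\<close>
    from \<epsilon> have "\<epsilon> / 8 > 0" by simp
    with elim(1) have "(\<lambda>N. max_abs_entry (F N \<omega>)) \<in> O(\<lambda>N. real N powr (- 1 / 2 + \<epsilon> / 8))" by blast
    then have "\<forall>\<^sub>F N in sequentially. \<bar>max_abs_entry (F N \<omega>)\<bar> \<le> \<delta> N"
      unfolding \<delta>_def by (rule bigo_powr_imp_le_powr) (use \<epsilon> in simp)
    with elim(3) show ?case
    proof eventually_elim
      case (elim N)
      have "\<forall>i<N. \<forall>k<N. \<bar>F N \<omega> $$ (i, k)\<bar> \<le> \<delta> N"
        using abs_entry_le_max_abs_entry[OF FC[OF \<open>\<omega> \<in> space \<Omega>\<close>, of N]] elim(2)
        by (meson abs_le_D1 order_trans)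
      moreover have "\<omega> \<notin> E N i j" if "i < N" "j < N" for i j
        using elim(1) that by (auto simp: B_def)
      ultimately show ?case
        using \<open>\<omega> \<in> space \<Omega>\<close> by (force simp: E_def t_def)
    qed
  qed
qed

text \<open>The exceptional null set must not depend on \<epsilon>. The values 1/(m+1) form a
  countable family, and the bound is monotone in \<epsilon> once N \<ge> 1.\<close>

lemma gram_form_AE_small_all:
  fixes F :: "nat \<Rightarrow> 'a \<Rightarrow> real mat" and a :: "nat \<Rightarrow> nat \<Rightarrow> real"
  assumes "prob_space \<Omega>" "\<And>N. F N \<in> \<Omega> \<rightarrow>\<^sub>M mat_borel N"
    and "\<And>N \<pi>. \<pi> permutes {..<N} \<Longrightarrow>
      distr \<Omega> (mat_borel N) (\<lambda>\<omega>. F N \<omega> * perm_mat N \<pi>) = distr \<Omega> (mat_borel N) (F N)"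
    and "AE \<omega> in \<Omega>. \<forall>\<epsilon>>0. (\<lambda>N. max_abs_entry (F N \<omega>)) \<in> O(\<lambda>N. real N powr (- 1 / 2 + \<epsilon>))"
    and "\<And>N. (\<Sum>k<N. a N k) = 0"
    and "\<forall>\<^sub>F N in sequentially. \<forall>k<N. \<bar>a N k\<bar> \<le> A"
  shows "AE \<omega> in \<Omega>. \<forall>\<epsilon>>0. \<forall>\<^sub>F N in sequentially. \<forall>i<N. \<forall>j<N.
    \<bar>\<Sum>k<N. F N \<omega> $$ (i, k) * F N \<omega> $$ (j, k) * a N k\<bar> \<le> real N powr (- 1 / 2 + \<epsilon>)"
proof -
  have "AE \<omega> in \<Omega>. \<forall>m. \<forall>\<^sub>F N in sequentially. \<forall>i<N. \<forall>j<N.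
      \<bar>\<Sum>k<N. F N \<omega> $$ (i, k) * F N \<omega> $$ (j, k) * a N k\<bar> \<le> real N powr (- 1 / 2 + inverse (real (Suc m)))"
    unfolding AE_all_countable 
    by (intro allI gram_form_AE_small[OF assms]) (simp_all add: add_pos_nonneg)
  then show ?thesis
  proof eventually_elim
    case (elim \<omega>)
    show ?case
    proof (intro allI impI)
      fix \<epsilon> :: real assume "\<epsilon> > 0"
      then obtain m where m: "inverse (real (Suc m)) < \<epsilon>" using reals_Archimedean by blast
      from elim[rule_format, of m] eventually_gt_at_top[of 0]
      show "\<forall>\<^sub>F N in sequentially. \<forall>i<N. \<forall>j<N.
        \<bar>\<Sum>k<N. F N \<omega> $$ (i, k) * F N \<omega> $$ (j, k) * a N k\<bar> \<le> real N powr (- 1 / 2 + \<epsilon>)"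
      proof eventually_elim
        case (elim N)
        have "real N powr (- 1 / 2 + inverse (real (Suc m))) \<le> real N powr (- 1 / 2 + \<epsilon>)"
          using elim(2) m by (intro powr_mono) auto
        with elim(1) show ?case by (meson order_trans)
      qed
    qed
  qed
qed

subsection \<open>Conjugates of diagonal matrices\<close>

lemma l2norm_vec_eq:
  "v \<in> carrier_vec n \<Longrightarrow> l2norm_vec v = sqrt (\<Sum>i<n. (vec_index v i)\<^sup>2)"
  by (auto simp: l2norm_vec_def scalar_prod_def lessThan_atLeast0 power2_eq_square)

lemma l2norm_vec_nonneg [simp]: "0 \<le> l2norm_vec v"
  by (simp add: l2norm_vec_def scalar_prod_def sum_nonneg)

text \<open>A real supremum is informative only over a nonempty bounded set: \<open>L\<close>
  supplies the bound and the zero vector the element.\<close>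

lemma
  assumes A: "A \<in> carrier_mat n n" and L: "0 \<le> L"
    and le: "\<And>v. v \<in> carrier_vec n \<Longrightarrow> l2norm_vec (A *\<^sub>v v) \<le> L * l2norm_vec v"
  shows l2norm_le_opnorm_mat:
      "\<And>v. v \<in> carrier_vec n \<Longrightarrow> l2norm_vec v \<le> 1 \<Longrightarrow> l2norm_vec (A *\<^sub>v v) \<le> opnorm_mat A"
    and abs_opnorm_mat_le: "\<bar>opnorm_mat A\<bar> \<le> L"
proof -
  let ?S = "{v \<in> carrier_vec (dim_col A). l2norm_vec v \<le> 1}"
  have bd: "l2norm_vec (A *\<^sub>v v) \<le> L" if "v \<in> ?S" for v
  proof -
    have "l2norm_vec (A *\<^sub>v v) \<le> L * l2norm_vec v" using le that A by auto
    also have "\<dots> \<le> L * 1" using that L by (intro mult_left_mono) auto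
    finally show ?thesis by simp
  qed
  have zero: "0\<^sub>v n \<in> ?S" using A by (simp add: l2norm_vec_def)
  show *: "l2norm_vec (A *\<^sub>v v) \<le> opnorm_mat A" if "v \<in> carrier_vec n" "l2norm_vec v \<le> 1" for v
    unfolding opnorm_mat_def by (rule cSUP_upper) (use that A bd in \<open>auto intro!: bdd_aboveI2\<close>)
  have "0 \<le> l2norm_vec (A *\<^sub>v 0\<^sub>v n)" by simp
  also have "\<dots> \<le> opnorm_mat A" using zero A by (intro *) auto
  finally have "0 \<le> opnorm_mat A" .
  moreover have "opnorm_mat A \<le> L"
    unfolding opnorm_mat_def by (rule cSUP_least) (use zero bd in auto)
  ultimately show "\<bar>opnorm_mat A\<bar> \<le> L" by simp
qed

lemma mat_diag_mult_vec:
  fixes d :: "nat \<Rightarrow> real"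
  assumes "v \<in> carrier_vec n"
  shows "mat_diag n d *\<^sub>v v = Matrix.vec n (\<lambda>i. d i * vec_index v i)"
proof (rule eq_vecI)
  fix i assume "i < dim_vec (Matrix.vec n (\<lambda>i. d i * vec_index v i))"
  then have i: "i < n" by simp
  have "vec_index (mat_diag n d *\<^sub>v v) i = (\<Sum>j<n. (if i = j then d j else 0) * vec_index v j)"
    using i assms by (auto simp: mat_diag_def scalar_prod_def lessThan_atLeast0 intro!: sum.cong)
  also have "\<dots> = (\<Sum>j<n. if j = i then d j * vec_index v j else 0)"
    by (intro sum.cong) auto
  finally show "vec_index (mat_diag n d *\<^sub>v v) i = vec_index (Matrix.vec n (\<lambda>i. d i * vec_index v i)) i"
    using i by simp
qed (auto simp: mat_diag_def)

lemma l2norm_mat_diag_mult_le: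
  fixes d :: "nat \<Rightarrow> real"
  assumes v: "v \<in> carrier_vec n" and d: "\<And>k. k < n \<Longrightarrow> \<bar>d k\<bar> \<le> L" and L: "0 \<le> L"
  shows "l2norm_vec (mat_diag n d *\<^sub>v v) \<le> L * l2norm_vec v"
proof -
  have "l2norm_vec (mat_diag n d *\<^sub>v v) = sqrt (\<Sum>i<n. (d i * vec_index v i)\<^sup>2)"
    unfolding mat_diag_mult_vec[OF v] by (subst l2norm_vec_eq[of _ n]) auto
  also have "\<dots> \<le> sqrt (\<Sum>i<n. L\<^sup>2 * (vec_index v i)\<^sup>2)"
    unfolding power_mult_distrib using d L
    by (intro real_sqrt_le_mono sum_mono mult_right_mono)
      (auto simp: abs_le_square_iff[symmetric])
  also have "\<dots> = L * l2norm_vec v"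
    using L by (simp add: l2norm_vec_eq[OF v] sum_distrib_left[symmetric] real_sqrt_mult)
  finally show ?thesis .
qed

text \<open>Testing on a unit vector; this converts the operator norm hypothesis on the diagonal
  matrix into bounds for its individual entries.\<close>

lemma abs_le_opnorm_mat_diag:
  fixes d :: "nat \<Rightarrow> real"
  assumes "k < n"
  shows "\<bar>d k\<bar> \<le> opnorm_mat (mat_diag n d)"
proof -
  \<comment> \<open>Only certifies that the supremum is over a bounded set; any common bound of the
    |d k| would serve.\<close>
  let ?L = "\<Sum>k<n. \<bar>d k\<bar>"
  have L: "\<bar>d k\<bar> \<le> ?L" if "k < n" for k
    using that by (intro member_le_sum) auto
  have sq: "(\<Sum>i<n. (c i * vec_index (unit_vec n k :: real vec) i)\<^sup>2) = (c k)\<^sup>2" for c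
  proof -
    have "(\<Sum>i<n. (c i * vec_index (unit_vec n k :: real vec) i)\<^sup>2) = (\<Sum>i<n. if i = k then (c i)\<^sup>2 else 0)"
      by (intro sum.cong) (auto simp: unit_vec_def)
    then show ?thesis using assms by simp
  qed
  have u: "(unit_vec n k :: real vec) \<in> carrier_vec n" by simp
  have "l2norm_vec (unit_vec n k) = 1"
    using sq[of "\<lambda>_. 1"] by (simp add: l2norm_vec_eq[OF u])
  then have "l2norm_vec (mat_diag n d *\<^sub>v unit_vec n k) \<le> opnorm_mat (mat_diag n d)"
    by (intro l2norm_le_opnorm_mat[where n=n and L="?L"] l2norm_mat_diag_mult_le L)
      (auto intro: sum_nonneg)
  moreover have "l2norm_vec (mat_diag n d *\<^sub>v unit_vec n k) = \<bar>d k\<bar>"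
    unfolding mat_diag_mult_vec[OF u] using sq[of d] by (subst l2norm_vec_eq[of _ n]) auto
  ultimately show ?thesis by simp
qed

lemma orthonormal_mat_transpose: "orthonormal_mat n A \<Longrightarrow> orthonormal_mat n (transpose_mat A)"
  by (auto simp: orthonormal_mat_def)

lemma l2norm_orthonormal_mult:
  assumes "orthonormal_mat n A" "v \<in> carrier_vec n"
  shows "l2norm_vec (A *\<^sub>v v) = l2norm_vec v"
proof -
  have A: "A \<in> carrier_mat n n" "transpose_mat A * A = 1\<^sub>m n"
    using assms(1) by (auto simp: orthonormal_mat_def)
  have "scalar_prod (A *\<^sub>v v) (A *\<^sub>v v) = scalar_prod (transpose_mat A *\<^sub>v (A *\<^sub>v v)) v"
    using A assms(2) by (intro transpose_vec_mult_scalar[symmetric]) auto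
  also have "transpose_mat A *\<^sub>v (A *\<^sub>v v) = (transpose_mat A * A) *\<^sub>v v"
    using A(1) assms(2) by (intro assoc_mult_mat_vec[symmetric]) auto
  also have "\<dots> = v" using A(2) assms(2) by simp
  finally show ?thesis by (simp add: l2norm_vec_def)
qed

lemma abs_opnorm_diag_conj_le:
  assumes A: "orthonormal_mat n A" and d: "\<And>k. k < n \<Longrightarrow> \<bar>d k\<bar> \<le> L" and L: "0 \<le> L"
  shows "\<bar>opnorm_mat (A * mat_diag n d * transpose_mat A)\<bar> \<le> L"
proof (rule abs_opnorm_mat_le[OF _ L])
  have AC: "A \<in> carrier_mat n n" using A by (simp add: orthonormal_mat_def)
  then show "A * mat_diag n d * transpose_mat A \<in> carrier_mat n n" by simp
  fix v :: "real vec" assume v: "v \<in> carrier_vec n"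
  let ?w = "transpose_mat A *\<^sub>v v"
  have w: "?w \<in> carrier_vec n" using AC v by auto
  have "A * mat_diag n d * transpose_mat A *\<^sub>v v = A * mat_diag n d *\<^sub>v ?w"
    by (rule assoc_mult_mat_vec[of _ n n _ n]) (use AC v in auto)
  also have "\<dots> = A *\<^sub>v (mat_diag n d *\<^sub>v ?w)"
    by (rule assoc_mult_mat_vec[of _ n n _ n]) (use AC w in auto)
  finally have "l2norm_vec (A * mat_diag n d * transpose_mat A *\<^sub>v v) = l2norm_vec (mat_diag n d *\<^sub>v ?w)"
    using l2norm_orthonormal_mult[OF A, of "mat_diag n d *\<^sub>v ?w"] w by (simp add: mat_diag_mult_vec)
  also have "\<dots> \<le> L * l2norm_vec ?w" by (rule l2norm_mat_diag_mult_le[OF w d L])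
  also have "l2norm_vec ?w = l2norm_vec v"
    by (rule l2norm_orthonormal_mult[OF orthonormal_mat_transpose[OF A] v])
  finally show "l2norm_vec (A * mat_diag n d * transpose_mat A *\<^sub>v v) \<le> L * l2norm_vec v" .
qed

text \<open>The conjugate is symmetric and the inner factor \<open>transpose_mat A * A\<close>
  cancels. Conditions on the Gram matrix thus have the same shape as those on the matrix, with
  squared diagonal entries.\<close>

lemma diag_conj_gram:
  fixes A :: "real mat"
  assumes "orthonormal_mat n A"
  shows "(A * mat_diag n d * transpose_mat A) * transpose_mat (A * mat_diag n d * transpose_mat A) =
    A * mat_diag n (\<lambda>k. (d k)\<^sup>2) * transpose_mat A" (is "?M * transpose_mat ?M = _")
proof -
  let ?D = "mat_diag n d" and ?B = "transpose_mat A"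
  have A: "A \<in> carrier_mat n n" "?B \<in> carrier_mat n n" "?D \<in> carrier_mat n n" "?B * A = 1\<^sub>m n"
    using assms by (auto simp: orthonormal_mat_def)
  have DB: "?D * ?B \<in> carrier_mat n n" "A * ?D \<in> carrier_mat n n"
    using A by (auto intro: mult_carrier_mat[of _ n n])
  have sym: "transpose_mat ?M = ?M"
    using A by (intro eq_matI) (auto simp: diag_conj_index[OF A(1)] mult.commute simp del: index_mult_mat(1))
  have "?M * ?M = A * ?D * (?B * (A * ?D * ?B))"
    by (rule assoc_mult_mat[of _ n n _ n _ n]) (use A DB in auto)
  also have "?B * (A * ?D * ?B) = ?B * (A * (?D * ?B))"
    by (subst assoc_mult_mat[of A n n ?D n ?B n]) (use A DB in auto)
  also have "\<dots> = (?B * A) * (?D * ?B)"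
    by (rule assoc_mult_mat[of _ n n _ n _ n, symmetric]) (use A DB in auto)
  also have "\<dots> = ?D * ?B" using A(4) DB(1) by (simp add: left_mult_one_mat[of _ n n])
  also have "A * ?D * (?D * ?B) = (A * ?D * ?D) * ?B"
    by (rule assoc_mult_mat[of _ n n _ n _ n, symmetric]) (use A DB in auto)
  also have "A * ?D * ?D = A * (?D * ?D)"
    by (rule assoc_mult_mat[of _ n n _ n _ n]) (use A DB in auto)
  also have "?D * ?D = mat_diag n (\<lambda>k. (d k)\<^sup>2)" by (simp add: power2_eq_square)
  finally show ?thesis unfolding sym .
qed

lemma orthonormal_mat_rows:
  assumes "orthonormal_mat n A" "i < n" "j < n"
  shows "(\<Sum>k<n. A $$ (i, k) * A $$ (j, k)) = (if i = j then 1 else 0)"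
proof -
  have A: "A \<in> carrier_mat n n" "A * transpose_mat A = 1\<^sub>m n"
    using assms(1) by (auto simp: orthonormal_mat_def)
  have "(A * transpose_mat A) $$ (i, j) = (\<Sum>k<n. A $$ (i, k) * A $$ (j, k))"
    using A(1) assms(2,3) by (auto simp: scalar_prod_def lessThan_atLeast0 intro!: sum.cong)
  then show ?thesis using A(2) assms(2,3) by simp
qed

text \<open>Orthonormal rows turn a constant diagonal \<open>m\<close> into \<open>m\<close> times
  the identity, so any \<open>m\<close> can be split off. Later \<open>m\<close> is the average of
  the diagonal, the value that makes the remaining coefficients sum to zero.\<close>

lemma diag_conj_index_centered:
  assumes A: "orthonormal_mat n A" and ij: "i < n" "j < n"
  shows "(A * mat_diag n d * transpose_mat A) $$ (i, j) =
    (\<Sum>k<n. A $$ (i, k) * A $$ (j, k) * (d k - m)) + (if i = j then m else 0)"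
proof -
  have "A \<in> carrier_mat n n" using A by (simp add: orthonormal_mat_def)
  from diag_conj_index[OF this ij, of d] show ?thesis
    using arg_cong[OF orthonormal_mat_rows[OF A ij], of "\<lambda>x. x * m"]
    by (simp add: right_diff_distrib sum_subtractf sum_distrib_right split: if_splits)
qed

section \<open>From centred sums to the four semi-random conditions\<close>

lemma abs_max_abs_entry_le:
  assumes "A \<in> carrier_mat n n" "n > 0" "\<And>i j. i < n \<Longrightarrow> j < n \<Longrightarrow> \<bar>A $$ (i, j)\<bar> \<le> c"
  shows "\<bar>max_abs_entry A\<bar> \<le> c"
proof -
  let ?S = "(\<lambda>(i, j). \<bar>A $$ (i, j)\<bar>) ` ({..<dim_row A} \<times> {..<dim_col A})"
  have "(0, 0) \<in> {..<dim_row A} \<times> {..<dim_col A}" using assms by auto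
  then have "Max ?S \<in> ?S" by (intro Max_in) auto
  then show ?thesis using assms unfolding max_abs_entry_def by auto
qed

lemma abs_max_abs_offdiag_le:
  assumes "A \<in> carrier_mat n n" "n > 1" "\<And>i j. i < n \<Longrightarrow> j < n \<Longrightarrow> i \<noteq> j \<Longrightarrow> \<bar>A $$ (i, j)\<bar> \<le> c"
  shows "\<bar>max_abs_offdiag A\<bar> \<le> c"
proof -
  let ?I = "{(i, j). i < dim_row A \<and> j < dim_col A \<and> i \<noteq> j}"
  let ?S = "(\<lambda>(i, j). \<bar>A $$ (i, j)\<bar>) ` ?I"
  have "(0, 1) \<in> ?I" using assms by auto
  moreover have "finite ?I" by (rule finite_subset[of _ "{..<dim_row A} \<times> {..<dim_col A}"]) auto
  ultimately have "Max ?S \<in> ?S" by (intro Max_in) auto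
  then show ?thesis using assms unfolding max_abs_offdiag_def by auto
qed

lemma abs_max_diag_deviation_le:
  assumes "A \<in> carrier_mat n n" "n > 0" "\<And>i. i < n \<Longrightarrow> \<bar>A $$ (i, i) - c\<bar> \<le> e"
  shows "\<bar>max_diag_deviation A c\<bar> \<le> e"
proof -
  let ?S = "(\<lambda>i. \<bar>A $$ (i, i) - c\<bar>) ` {..<dim_row A}"
  have "Max ?S \<in> ?S" using assms by (intro Max_in) auto
  then show ?thesis using assms unfolding max_diag_deviation_def by auto
qed

text \<open>Deterministic, to be applied to one realization at a time. The averages act differently:
  \<open>m\<^sub>1\<close> is itself O(N^(-1/2+\<epsilon>)) and is absorbed in the entry bound,
  while \<open>m\<^sub>2\<close> is absent off the diagonal and supplies the limit \<open>c\<close>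
  on it.\<close>

lemma diag_conj_semi_random_conditions:
  fixes A :: "nat \<Rightarrow> real mat" and d :: "nat \<Rightarrow> nat \<Rightarrow> real"
  assumes A: "\<And>N. orthonormal_mat N (A N)" and L: "0 \<le> L"
    and bd: "\<forall>\<^sub>F N in sequentially. \<forall>k<N. \<bar>d N k\<bar> \<le> L"
    and d1: "\<forall>\<epsilon>>0. \<forall>\<^sub>F N in sequentially. \<forall>i<N. \<forall>j<N.
      \<bar>\<Sum>k<N. A N $$ (i, k) * A N $$ (j, k) * (d N k - m\<^sub>1 N)\<bar> \<le> real N powr (- 1 / 2 + \<epsilon>)"
    and d2: "\<forall>\<epsilon>>0. \<forall>\<^sub>F N in sequentially. \<forall>i<N. \<forall>j<N.
      \<bar>\<Sum>k<N. A N $$ (i, k) * A N $$ (j, k) * ((d N k)\<^sup>2 - m\<^sub>2 N)\<bar> \<le> real N powr (- 1 / 2 + \<epsilon>)"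
    and m1: "\<And>\<epsilon>. \<epsilon> > 0 \<Longrightarrow> m\<^sub>1 \<in> O(\<lambda>N. real N powr (- 1 / 2 + \<epsilon>))"
    and m2: "m\<^sub>2 \<longlonglongrightarrow> c"
  defines "\<Psi> \<equiv> \<lambda>N. A N * mat_diag N (d N) * transpose_mat (A N)"
  shows "(\<forall>\<epsilon>>0. (\<lambda>N. max_abs_entry (\<Psi> N)) \<in> O(\<lambda>N. real N powr (- 1 / 2 + \<epsilon>))) \<and>
    (\<lambda>N. opnorm_mat (\<Psi> N)) \<in> O(\<lambda>N. 1) \<and>
    (\<forall>\<epsilon>>0. (\<lambda>N. max_abs_offdiag (\<Psi> N * transpose_mat (\<Psi> N))) \<in> O(\<lambda>N. real N powr (- 1 / 2 + \<epsilon>))) \<and>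
    (\<lambda>N. max_diag_deviation (\<Psi> N * transpose_mat (\<Psi> N)) c) \<longlonglongrightarrow> 0"
proof (intro conjI allI impI)
  have AC: "A N \<in> carrier_mat N N" for N using A by (simp add: orthonormal_mat_def)
  have gram: "\<Psi> N * transpose_mat (\<Psi> N) = A N * mat_diag N (\<lambda>k. (d N k)\<^sup>2) * transpose_mat (A N)" for N
    unfolding \<Psi>_def by (rule diag_conj_gram[OF A])
  show "(\<lambda>N. opnorm_mat (\<Psi> N)) \<in> O(\<lambda>N. 1)"
    by (rule bigoI[of _ L], use bd in eventually_elim)
      (use L in \<open>auto simp: \<Psi>_def intro!: abs_opnorm_diag_conj_le A\<close>)
  fix \<epsilon> :: real assume \<epsilon>: "\<epsilon> > 0"
  have "\<forall>\<^sub>F N in sequentially. norm (max_abs_entry (\<Psi> N)) \<le> norm (real N powr (- 1 / 2 + \<epsilon>) + \<bar>m\<^sub>1 N\<bar>)"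
    using d1[rule_format, OF \<epsilon>] eventually_gt_at_top[of 0]
  proof eventually_elim
    case (elim N)
    have "\<bar>max_abs_entry (\<Psi> N)\<bar> \<le> real N powr (- 1 / 2 + \<epsilon>) + \<bar>m\<^sub>1 N\<bar>"
      unfolding \<Psi>_def
    proof (rule abs_max_abs_entry_le[OF diag_conj_carrier[OF AC] elim(2)])
      fix i j assume ij: "i < N" "j < N"
      from elim(1) ij have "\<bar>\<Sum>k<N. A N $$ (i, k) * A N $$ (j, k) * (d N k - m\<^sub>1 N)\<bar> \<le> real N powr (- 1 / 2 + \<epsilon>)"
        by blast
      then show "\<bar>(A N * mat_diag N (d N) * transpose_mat (A N)) $$ (i, j)\<bar> \<le>
          real N powr (- 1 / 2 + \<epsilon>) + \<bar>m\<^sub>1 N\<bar>"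
        unfolding diag_conj_index_centered[OF A ij, of _ "m\<^sub>1 N"] by auto
    qed
    then show ?case by simp
  qed
  then have "(\<lambda>N. max_abs_entry (\<Psi> N)) \<in> O(\<lambda>N. real N powr (- 1 / 2 + \<epsilon>) + \<bar>m\<^sub>1 N\<bar>)"
    by (rule landau_o.big_mono)
  also have "(\<lambda>N. real N powr (- 1 / 2 + \<epsilon>) + \<bar>m\<^sub>1 N\<bar>) \<in> O(\<lambda>N. real N powr (- 1 / 2 + \<epsilon>))"
    by (intro sum_in_bigo) (use m1[OF \<epsilon>] in auto)
  finally show "(\<lambda>N. max_abs_entry (\<Psi> N)) \<in> O(\<lambda>N. real N powr (- 1 / 2 + \<epsilon>))" .
  have "\<forall>\<^sub>F N in sequentially. norm (max_abs_offdiag (\<Psi> N * transpose_mat (\<Psi> N))) \<le>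
      norm (real N powr (- 1 / 2 + \<epsilon>))"
    using d2[rule_format, OF \<epsilon>] eventually_gt_at_top[of 1]
  proof eventually_elim
    case (elim N)
    have "\<bar>max_abs_offdiag (\<Psi> N * transpose_mat (\<Psi> N))\<bar> \<le> real N powr (- 1 / 2 + \<epsilon>)"
      unfolding gram
    proof (rule abs_max_abs_offdiag_le[OF diag_conj_carrier[OF AC] elim(2)])
      fix i j assume ij: "i < N" "j < N" "i \<noteq> j"
      with elim(1) show "\<bar>(A N * mat_diag N (\<lambda>k. (d N k)\<^sup>2) * transpose_mat (A N)) $$ (i, j)\<bar> \<le>
          real N powr (- 1 / 2 + \<epsilon>)"
        unfolding diag_conj_index_centered[OF A ij(1,2), of _ "m\<^sub>2 N"] by simp
    qed
    then show ?case by simp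
  qed
  then show "(\<lambda>N. max_abs_offdiag (\<Psi> N * transpose_mat (\<Psi> N))) \<in> O(\<lambda>N. real N powr (- 1 / 2 + \<epsilon>))"
    by (rule landau_o.big_mono)
next
  have AC: "A N \<in> carrier_mat N N" for N using A by (simp add: orthonormal_mat_def)
  have gram: "\<Psi> N * transpose_mat (\<Psi> N) = A N * mat_diag N (\<lambda>k. (d N k)\<^sup>2) * transpose_mat (A N)" for N
    unfolding \<Psi>_def by (rule diag_conj_gram[OF A])
  \<comment> \<open>Convergence to 0 needs no sharp rate; 1/4 is one choice of \<epsilon> below 1/2,
    which keeps the exponent negative.\<close>
  have "\<forall>\<^sub>F N in sequentially. \<forall>i<N. \<forall>j<N.
      \<bar>\<Sum>k<N. A N $$ (i, k) * A N $$ (j, k) * ((d N k)\<^sup>2 - m\<^sub>2 N)\<bar> \<le> real N powr (- 1 / 2 + 1 / 4)"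
    by (rule d2[rule_format]) simp
  then have "\<forall>\<^sub>F N in sequentially. norm (max_diag_deviation (\<Psi> N * transpose_mat (\<Psi> N)) c) \<le>
      real N powr (- 1 / 2 + 1 / 4) + \<bar>m\<^sub>2 N - c\<bar>"
    using eventually_gt_at_top[of 0]
  proof eventually_elim
    case (elim N)
    have "\<bar>max_diag_deviation (\<Psi> N * transpose_mat (\<Psi> N)) c\<bar> \<le> real N powr (- 1 / 2 + 1 / 4) + \<bar>m\<^sub>2 N - c\<bar>"
      unfolding gram
    proof (rule abs_max_diag_deviation_le[OF diag_conj_carrier[OF AC] elim(2)])
      fix i assume i: "i < N"
      have "\<bar>\<Sum>k<N. A N $$ (i, k) * A N $$ (i, k) * ((d N k)\<^sup>2 - m\<^sub>2 N)\<bar> \<le> real N powr (- 1 / 2 + 1 / 4)"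
        using elim(1) i by blast
      then show "\<bar>(A N * mat_diag N (\<lambda>k. (d N k)\<^sup>2) * transpose_mat (A N)) $$ (i, i) - c\<bar> \<le>
          real N powr (- 1 / 2 + 1 / 4) + \<bar>m\<^sub>2 N - c\<bar>"
        unfolding diag_conj_index_centered[OF A i i, of _ "m\<^sub>2 N"] if_P[OF refl] by linarith
    qed
    then show ?case by simp
  qed
  moreover have "(\<lambda>N. real N powr (- 1 / 2 + 1 / 4) + \<bar>m\<^sub>2 N - c\<bar>) \<longlonglongrightarrow> 0"
  proof (rule tendsto_add_zero)
    show "(\<lambda>N. real N powr (- 1 / 2 + 1 / 4)) \<longlonglongrightarrow> 0"
      by (rule tendsto_neg_powr[OF _ filterlim_real_sequentially]) simp
    show "(\<lambda>N. \<bar>m\<^sub>2 N - c\<bar>) \<longlonglongrightarrow> 0"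
      using m2 by (intro tendsto_rabs_zero LIM_zero)
  qed
  ultimately show "(\<lambda>N. max_diag_deviation (\<Psi> N * transpose_mat (\<Psi> N)) c) \<longlonglongrightarrow> 0"
    by (rule Lim_null_comparison)
qed

section \<open>Averages, sign conjugation and measurability\<close>

lemma abs_diff_average_le:
  fixes d :: "nat \<Rightarrow> real"
  assumes "\<And>k. k < n \<Longrightarrow> \<bar>d k\<bar> \<le> c" "j < n"
  shows "\<bar>d j - (\<Sum>k<n. d k) / real n\<bar> \<le> 2 * c"
proof -
  have "\<bar>\<Sum>k<n. d k\<bar> \<le> (\<Sum>k<n. c)"
    by (rule order_trans[OF sum_abs sum_mono]) (use assms(1) in auto)
  then have "\<bar>(\<Sum>k<n. d k) / real n\<bar> \<le> c"
    using assms(2) by (simp add: abs_divide field_simps)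
  with assms(1)[OF assms(2)] show ?thesis by linarith
qed

lemma sum_diff_average:
  fixes d :: "nat \<Rightarrow> real"
  shows "(\<Sum>k<n. d k - (\<Sum>k<n. d k) / real n) = 0"
  by (cases "n = 0") (simp_all add: sum_subtractf)

lemma mat_trace_mat_diag: "mat_trace (mat_diag n d) = (\<Sum>k<n. d k)"
  by (simp add: mat_trace_def mat_diag_def)

text \<open>Signs commute with nothing here, but outer signs can be absorbed into \<open>A\<close>
  as row signs. This is how conjugating the matrix by \<open>S\<close> becomes an instance of the
  row invariance of \<open>F\<close>.\<close>

lemma sign_conj_diag_conj:
  fixes A :: "real mat"
  assumes A: "A \<in> carrier_mat n n"
  shows "mat_diag n s * (A * mat_diag n d * transpose_mat A) * mat_diag n s =
    (mat_diag n s * A) * mat_diag n d * transpose_mat (mat_diag n s * A)"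
proof (rule eq_matI)
  have sA: "mat_diag n s * A \<in> carrier_mat n n" using A by (intro mult_carrier_mat[of _ n n]) auto
  fix i j assume "i < dim_row (mat_diag n s * A * mat_diag n d * transpose_mat (mat_diag n s * A))"
    "j < dim_col (mat_diag n s * A * mat_diag n d * transpose_mat (mat_diag n s * A))"
  with sA have ij: "i < n" "j < n" by auto
  let ?M = "A * mat_diag n d * transpose_mat A"
  have M: "?M \<in> carrier_mat n n" using A by simp
  then have sM: "mat_diag n s * ?M \<in> carrier_mat n n" by (rule mult_carrier_mat[OF mat_diag_dim])
  have "(mat_diag n s * ?M * mat_diag n s) $$ (i, j) = s i * ?M $$ (i, j) * s j"
    using ij by (subst mat_diag_mult_right[OF sM]) (simp add: mat_diag_mult_left[OF M] del: index_mult_mat(1))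
  also have "\<dots> = (\<Sum>k<n. (s i * A $$ (i, k)) * (s j * A $$ (j, k)) * d k)"
    unfolding diag_conj_index[OF A ij] by (simp add: sum_distrib_left sum_distrib_right algebra_simps)
  also have "\<dots> = (mat_diag n s * A * mat_diag n d * transpose_mat (mat_diag n s * A)) $$ (i, j)"
    unfolding diag_conj_index[OF sA ij] using ij
    by (intro sum.cong) (auto simp: mat_diag_mult_left[OF A] simp del: index_mult_mat(1))
  finally show "(mat_diag n s * ?M * mat_diag n s) $$ (i, j) =
    (mat_diag n s * A * mat_diag n d * transpose_mat (mat_diag n s * A)) $$ (i, j)" .
qed (use A in \<open>auto simp: mat_diag_def\<close>)

lemma measurable_diag_conj:
  "(\<lambda>A. A * mat_diag n d * transpose_mat A) \<in> mat_borel n \<rightarrow>\<^sub>M mat_borel n"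
proof (rule measurable_mat_borelI)
  fix i j assume ij: "i < n" "j < n"
  have "(\<lambda>A. \<Sum>k<n. A $$ (i, k) * A $$ (j, k) * d k) \<in> borel_measurable (mat_borel n)"
    using ij by (intro borel_measurable_sum borel_measurable_times borel_measurable_const
        measurable_mat_borel_entry) auto
  then show "(\<lambda>A. (A * mat_diag n d * transpose_mat A) $$ (i, j)) \<in> borel_measurable (mat_borel n)"
    by (rule measurable_cong[THEN iffD1, rotated]) (simp add: diag_conj_index ij del: index_mult_mat(1))
qed simp

lemma measurable_sign_conj:
  assumes s: "\<And>i. i < n \<Longrightarrow> (\<lambda>x. s x i) \<in> borel_measurable M" and A: "A \<in> M \<rightarrow>\<^sub>M mat_borel n"
  shows "(\<lambda>x. mat_diag n (s x) * A x * mat_diag n (s x)) \<in> M \<rightarrow>\<^sub>M mat_borel n"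
proof (rule measurable_mat_borelI)
  have AC: "A x \<in> carrier_mat n n" if "x \<in> space M" for x
    using measurable_space[OF A that] by simp
  then show "mat_diag n (s x) * A x * mat_diag n (s x) \<in> carrier_mat n n" if "x \<in> space M" for x
    using that by (intro mult_carrier_mat[of _ n n]) auto
  fix i j assume ij: "i < n" "j < n"
  have "(mat_diag n (s x) * A x * mat_diag n (s x)) $$ (i, j) = s x i * A x $$ (i, j) * s x j"
    if "x \<in> space M" for x
  proof -
    have sA: "mat_diag n (s x) * A x \<in> carrier_mat n n" using AC[OF that] by (intro mult_carrier_mat[of _ n n]) auto
    show ?thesis
      using ij by (subst mat_diag_mult_right[OF sA])
        (simp add: mat_diag_mult_left[OF AC[OF that]] del: index_mult_mat(1))
  qed
  moreover have "(\<lambda>x. s x i * A x $$ (i, j) * s x j) \<in> borel_measurable M"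
    using ij by (intro borel_measurable_times s measurable_compose[OF A measurable_mat_borel_entry])
  ultimately show "(\<lambda>x. (mat_diag n (s x) * A x * mat_diag n (s x)) $$ (i, j)) \<in> borel_measurable M"
    by (subst measurable_cong) auto
qed

lemma measurable_mat_diag:
  assumes "\<And>i. i < n \<Longrightarrow> (\<lambda>x. s x i) \<in> borel_measurable M"
  shows "(\<lambda>x. mat_diag n (s x) :: real mat) \<in> M \<rightarrow>\<^sub>M mat_borel n"
proof (rule measurable_mat_borelI)
  fix i j assume "i < n" "j < n"
  then show "(\<lambda>x. mat_diag n (s x) $$ (i, j)) \<in> borel_measurable M"
    using assms by (cases "i = j") (simp_all add: mat_diag_def)
qed simp

subsection \<open>Random signs on a product space\<close>

lemma distr_pair_snd:
  assumes "prob_space M" "prob_space N"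
  shows "distr (M \<Otimes>\<^sub>M N) N snd = N"
proof -
  interpret M: prob_space M by fact
  interpret N: prob_space N by fact
  interpret pair_prob_space N M ..
  have "distr (M \<Otimes>\<^sub>M N) N snd = distr (distr (M \<Otimes>\<^sub>M N) (N \<Otimes>\<^sub>M M) (\<lambda>(x, y). (y, x))) N fst"
    by (subst distr_distr) (auto intro!: distr_cong)
  also have "\<dots> = N"
    by (subst distr_pair_swap[symmetric]) (rule M.distr_pair_fst)
  finally show ?thesis .
qed

text \<open>The joint law is the product of the marginal laws. The second coordinate is listed first
  because the signs live there and \<open>semi_random_as\<close> names them before
  \<open>\<Psi>\<close>.\<close>

lemma indep_var_snd_fst:
  assumes "prob_space M" "prob_space N"
    and f: "f \<in> N \<rightarrow>\<^sub>M K" and g: "g \<in> M \<rightarrow>\<^sub>M L"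
  shows "prob_space.indep_var (M \<Otimes>\<^sub>M N) K (\<lambda>x. f (snd x)) L (\<lambda>x. g (fst x))"
proof -
  interpret M: prob_space M by fact
  interpret N: prob_space N by fact
  interpret MN: pair_prob_space M N ..
  interpret NM: pair_prob_space N M ..
  interpret L: prob_space "distr M L g" by (rule M.prob_space_distr[OF g])
  note [measurable] = f g
  have 1: "distr (M \<Otimes>\<^sub>M N) K (\<lambda>x. f (snd x)) = distr N K f"
    using distr_distr[OF f measurable_snd[of M N]] by (simp add: distr_pair_snd[OF assms(1,2)] comp_def)
  have 2: "distr (M \<Otimes>\<^sub>M N) L (\<lambda>x. g (fst x)) = distr M L g"
    using distr_distr[OF g measurable_fst[of M N]] by (simp add: N.distr_pair_fst comp_def)
  have "distr N K f \<Otimes>\<^sub>M distr M L g = distr (N \<Otimes>\<^sub>M M) (K \<Otimes>\<^sub>M L) (\<lambda>(y, x). (f y, g x))"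
    by (rule pair_measure_distr[OF f g]) unfold_locales
  also have "\<dots> = distr (M \<Otimes>\<^sub>M N) (K \<Otimes>\<^sub>M L) (\<lambda>x. (f (snd x), g (fst x)))"
    by (subst NM.distr_pair_swap, subst distr_distr) (auto simp: comp_def case_prod_unfold)
  finally show ?thesis by (simp add: MN.indep_var_distribution_eq 1 2)
qed

text \<open>Stated for a variable \<open>X\<close> with product law, not for the identity on the
  product space, since the coins are one coordinate of a larger sample space.\<close>

lemma
  fixes X :: "'a \<Rightarrow> 'i \<Rightarrow> 'b"
  assumes "prob_space \<Omega>" and M: "\<And>i. prob_space (M i)"
    and X: "X \<in> \<Omega> \<rightarrow>\<^sub>M Pi\<^sub>M UNIV M" and law: "distr \<Omega> (Pi\<^sub>M UNIV M) X = Pi\<^sub>M UNIV M"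
  shows distr_PiM_coordinate: "distr \<Omega> (M i) (\<lambda>\<omega>. X \<omega> i) = M i"
    and indep_vars_PiM_coordinates:
      "finite J \<Longrightarrow> prob_space.indep_vars \<Omega> M (\<lambda>i \<omega>. X \<omega> i) J"
proof -
  interpret prob_space \<Omega> by fact
  interpret P: product_prob_space M UNIV by (rule product_prob_spaceI) (rule M)
  have meas: "(\<lambda>\<omega>. X \<omega> i) \<in> \<Omega> \<rightarrow>\<^sub>M M i" for i
    using measurable_compose[OF X measurable_component_singleton[of i UNIV M]] by simp
  have "distr \<Omega> (M i) (\<lambda>\<omega>. X \<omega> i) = distr (distr \<Omega> (Pi\<^sub>M UNIV M) X) (M i) (\<lambda>b. b i)" for i
    by (subst distr_distr[OF _ X]) (auto simp: comp_def)
  then show 1: "distr \<Omega> (M i) (\<lambda>\<omega>. X \<omega> i) = M i" for i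
    unfolding law using distr_PiM_component[of UNIV M i] M by simp
  assume J: "finite J"
  have "distr \<Omega> (Pi\<^sub>M J M) (\<lambda>\<omega>. \<lambda>i\<in>J. X \<omega> i) =
      distr (distr \<Omega> (Pi\<^sub>M UNIV M) X) (Pi\<^sub>M J M) (\<lambda>b. restrict b J)"
    by (subst distr_distr[OF _ X]) (auto simp: comp_def intro!: measurable_restrict_subset)
  also have "\<dots> = Pi\<^sub>M J M"
    unfolding law using J by (intro P.distr_PiM_restrict_finite) auto
  finally have J_law: "distr \<Omega> (Pi\<^sub>M J M) (\<lambda>\<omega>. \<lambda>i\<in>J. X \<omega> i) = (\<Pi>\<^sub>M i\<in>J. distr \<Omega> (M i) (\<lambda>\<omega>. X \<omega> i))"
    by (simp add: 1)
  show "indep_vars M (\<lambda>i \<omega>. X \<omega> i) J"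
  \<comment> \<open>The characterisation of independence by the joint law asks for a nonempty index
    set; the empty one occurs for N = 0.\<close>
  proof (cases "J = {}")
    case True
    then show ?thesis by (simp add: indep_vars_def indep_sets_def)
  next
    case False
    then show ?thesis
      using indep_vars_iff_distr_eq_PiM'[OF False, where M'=M and X="\<lambda>i \<omega>. X \<omega> i"] meas J_law by simp
  qed
qed

text \<open>The sample space of a coin is all of the natural numbers. Null values also receive a
  sign, so that membership in {-1, 1} holds everywhere and not just almost surely, as measurability
  into \<open>count_space {-1, 1}\<close> demands.\<close>

definition coin_sign :: "nat \<Rightarrow> real" where
  "coin_sign k = (if k = 0 then - 1 else 1)"

text \<open>One coin sequence provides the signs for all \<open>N\<close>: \<open>semi_random_as\<close> leaves the joint law
  of the sign matrices over different \<open>N\<close> unrestricted.\<close>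

definition coins :: "(nat \<Rightarrow> nat) measure" where
  "coins = Pi\<^sub>M UNIV (\<lambda>_. measure_pmf (pmf_of_set {0, 1}))"

lemma coin_sign_cases: "coin_sign k \<in> {-1, 1}"
  by (simp add: coin_sign_def)

lemma prob_space_coins: "prob_space coins"
  unfolding coins_def by (intro prob_space_PiM) (rule prob_space_measure_pmf)

lemma measurable_coin_sign [measurable]: "(\<lambda>b. coin_sign (b i)) \<in> borel_measurable coins"
proof -
  have "(\<lambda>b. b i) \<in> coins \<rightarrow>\<^sub>M measure_pmf (pmf_of_set {0, 1})"
    unfolding coins_def by simp
  then show ?thesis by (rule measurable_compose) simp
qed

lemma distr_coin_sign:
  "distr (measure_pmf (pmf_of_set {0, 1})) (count_space {-1, 1}) coin_sign = uniform_count_measure {-1, 1}"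
proof (rule measure_eqI_finite)
  fix a :: real assume a: "a \<in> {-1, 1}"
  have m: "coin_sign \<in> measure_pmf (pmf_of_set {0, 1}) \<rightarrow>\<^sub>M count_space {-1, 1}"
    using coin_sign_cases by (intro measurableI) auto
  have "emeasure (distr (measure_pmf (pmf_of_set {0, 1})) (count_space {-1, 1}) coin_sign) {a} =
      emeasure (measure_pmf (pmf_of_set {0, 1})) (coin_sign -` {a})"
    using a by (subst emeasure_distr[OF m]) auto
  also have "\<dots> = ennreal (1 / 2)"
    using a by (subst emeasure_pmf_of_set) (auto simp: coin_sign_def Int_insert_left)
  also have "\<dots> = emeasure (uniform_count_measure {-1, 1}) {a}"
    using a by (subst emeasure_uniform_count_measure) auto
  finally show "emeasure (distr (measure_pmf (pmf_of_set {0, 1})) (count_space {-1, 1}) coin_sign) {a} =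
    emeasure (uniform_count_measure {-1, 1}) {a}" .
qed (auto simp: sets_uniform_count_measure)

text \<open>Fubini with the coins frozen: each slice involves a deterministic sign matrix, to which
  \<open>inv\<close> applies. All slices have the same measure, so integrating over the coins
  changes nothing.\<close>

lemma distr_random_signs_conj:
  fixes F :: "'a \<Rightarrow> real mat" and d :: "nat \<Rightarrow> real"
  assumes "prob_space \<Omega>" and F: "F \<in> \<Omega> \<rightarrow>\<^sub>M mat_borel n"
    and inv: "\<And>D. D \<in> sign_mats n \<Longrightarrow>
      distr \<Omega> (mat_borel n) (\<lambda>\<omega>. D * F \<omega>) = distr \<Omega> (mat_borel n) F"
  defines "G \<equiv> \<lambda>A :: real mat. A * mat_diag n d * transpose_mat A"
  shows "distr (\<Omega> \<Otimes>\<^sub>M coins) (mat_borel n)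
      (\<lambda>x. mat_diag n (\<lambda>i. coin_sign (snd x i)) * G (F (fst x)) * mat_diag n (\<lambda>i. coin_sign (snd x i))) =
    distr \<Omega> (mat_borel n) (\<lambda>\<omega>. G (F \<omega>))" (is "distr _ _ ?M = _")
proof (rule measure_eqI)
  interpret prob_space \<Omega> by fact
  interpret C: prob_space coins by (rule prob_space_coins)
  interpret pair_prob_space \<Omega> coins ..
  have G: "G \<in> mat_borel n \<rightarrow>\<^sub>M mat_borel n" unfolding G_def by (rule measurable_diag_conj)
  have FC: "F \<omega> \<in> carrier_mat n n" if "\<omega> \<in> space \<Omega>" for \<omega>
    using measurable_space[OF F that] by simp
  have M: "?M \<in> \<Omega> \<Otimes>\<^sub>M coins \<rightarrow>\<^sub>M mat_borel n"
    by (intro measurable_sign_conj measurable_compose[OF _ measurable_coin_sign]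
        measurable_compose[OF measurable_compose[OF _ F] G] measurable_fst measurable_snd
        measurable_compose[OF measurable_snd measurable_coin_sign])
  fix H assume "H \<in> sets (distr (\<Omega> \<Otimes>\<^sub>M coins) (mat_borel n) ?M)"
  then have H: "H \<in> sets (mat_borel n)" by simp
  then have GH: "G -` H \<inter> space (mat_borel n) \<in> sets (mat_borel n)" by (rule measurable_sets[OF G])
  have slice: "emeasure \<Omega> ((\<lambda>\<omega>. (\<omega>, b)) -` (?M -` H \<inter> space (\<Omega> \<Otimes>\<^sub>M coins))) =
      emeasure (distr \<Omega> (mat_borel n) (\<lambda>\<omega>. G (F \<omega>))) H" if b: "b \<in> space coins" for b
  proof -
    let ?D = "mat_diag n (\<lambda>i. coin_sign (b i))"
    have D: "?D \<in> sign_mats n" using coin_sign_cases by (auto simp: sign_mats_def)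
    have DF: "(\<lambda>\<omega>. ?D * F \<omega>) \<in> \<Omega> \<rightarrow>\<^sub>M mat_borel n"
    proof (rule measurable_mat_borelI)
      show DFC: "?D * F \<omega> \<in> carrier_mat n n" if "\<omega> \<in> space \<Omega>" for \<omega>
        using FC[OF that] by (rule mult_carrier_mat[OF mat_diag_dim])
      fix i j assume ij: "i < n" "j < n"
      have "(\<lambda>\<omega>. coin_sign (b i) * F \<omega> $$ (i, j)) \<in> borel_measurable \<Omega>"
        by (intro borel_measurable_times borel_measurable_const
            measurable_compose[OF F measurable_mat_borel_entry] ij)
      then show "(\<lambda>\<omega>. (?D * F \<omega>) $$ (i, j)) \<in> borel_measurable \<Omega>"
        by (rule measurable_cong[THEN iffD1, rotated])
          (simp add: mat_diag_mult_left[OF FC] ij del: index_mult_mat(1))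
    qed
    have "(\<lambda>\<omega>. (\<omega>, b)) -` (?M -` H \<inter> space (\<Omega> \<Otimes>\<^sub>M coins)) =
        (\<lambda>\<omega>. ?D * F \<omega>) -` (G -` H \<inter> space (mat_borel n)) \<inter> space \<Omega>"
      using b measurable_space[OF DF]
      by (auto simp: space_pair_measure G_def sign_conj_diag_conj[OF FC])
    then have "emeasure \<Omega> ((\<lambda>\<omega>. (\<omega>, b)) -` (?M -` H \<inter> space (\<Omega> \<Otimes>\<^sub>M coins))) =
        emeasure (distr \<Omega> (mat_borel n) (\<lambda>\<omega>. ?D * F \<omega>)) (G -` H \<inter> space (mat_borel n))"
      by (simp only: emeasure_distr[OF DF GH])
    also have "\<dots> = emeasure (distr \<Omega> (mat_borel n) F) (G -` H \<inter> space (mat_borel n))"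
      by (simp only: inv[OF D])
    also have "\<dots> = emeasure (distr (distr \<Omega> (mat_borel n) F) (mat_borel n) G) H"
      using G H by (simp add: emeasure_distr)
    also have "\<dots> = emeasure (distr \<Omega> (mat_borel n) (\<lambda>\<omega>. G (F \<omega>))) H"
      by (simp add: distr_distr[OF G F] comp_def)
    finally show ?thesis .
  qed
  have "emeasure (distr (\<Omega> \<Otimes>\<^sub>M coins) (mat_borel n) ?M) H =
      (\<integral>\<^sup>+ b. emeasure \<Omega> ((\<lambda>\<omega>. (\<omega>, b)) -` (?M -` H \<inter> space (\<Omega> \<Otimes>\<^sub>M coins))) \<partial>coins)"
    by (subst emeasure_distr[OF M H], subst emeasure_pair_measure_alt2[OF measurable_sets[OF M H]]) simp
  also have "\<dots> = (\<integral>\<^sup>+ b. emeasure (distr \<Omega> (mat_borel n) (\<lambda>\<omega>. G (F \<omega>))) H \<partial>coins)"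
    by (intro nn_integral_cong slice)
  also have "\<dots> = emeasure (distr \<Omega> (mat_borel n) (\<lambda>\<omega>. G (F \<omega>))) H"
    by (simp add: C.emeasure_space_1)
  finally show "emeasure (distr (\<Omega> \<Otimes>\<^sub>M coins) (mat_borel n) ?M) H =
    emeasure (distr \<Omega> (mat_borel n) (\<lambda>\<omega>. G (F \<omega>))) H" .
qed simp

theorem lemma2:
  fixes \<Omega> :: "'a measure"
    and F :: "nat \<Rightarrow> 'a \<Rightarrow> real mat"
    and l :: "nat \<Rightarrow> nat \<Rightarrow> real"
    and \<Lambda> :: "nat \<Rightarrow> real mat"
    and M :: "nat \<Rightarrow> 'a \<Rightarrow> real mat"
    and \<sigma> :: real
  assumes "prob_space \<Omega>"
    and F_random: "\<And>N. F N \<in> \<Omega> \<rightarrow>\<^sub>M mat_borel N"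
    and F_orthogonal: "\<And>N. AE \<omega> in \<Omega>. orthonormal_mat N (F N \<omega>)"
    and F_delocalized:
      "AE \<omega> in \<Omega>. \<forall>\<epsilon>>0. (\<lambda>N. max_abs_entry (F N \<omega>)) \<in> O(\<lambda>N. real N powr (- 1 / 2 + \<epsilon>))"
    and F_invariant:
      "\<And>N D P. D \<in> sign_mats N \<Longrightarrow> P \<in> permutation_mats N \<Longrightarrow>
         distr \<Omega> (mat_borel N) (\<lambda>\<omega>. D * F N \<omega> * P) = distr \<Omega> (mat_borel N) (F N)"
    and \<Lambda>_diag: "\<And>N. \<Lambda> N = mat_diag N (l N)"
    and \<Lambda>_bounded: "(\<lambda>N. opnorm_mat (\<Lambda> N)) \<in> O(\<lambda>N. 1)"
    and \<Lambda>_trace: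
      "\<And>\<epsilon>. \<epsilon> > 0 \<Longrightarrow> (\<lambda>N. mat_trace (\<Lambda> N) / real N) \<in> O(\<lambda>N. real N powr (- 1 / 2 + \<epsilon>))"
    and \<Lambda>_trace_sq: "(\<lambda>N. mat_trace (\<Lambda> N * \<Lambda> N) / real N) \<longlonglongrightarrow> \<sigma>\<^sup>2"
    and \<sigma>_pos: "\<sigma>\<^sup>2 > 0"
    and M_eq: "\<And>N \<omega>. \<omega> \<in> space \<Omega> \<Longrightarrow> M N \<omega> = F N \<omega> * \<Lambda> N * transpose_mat (F N \<omega>)"
  shows "\<exists>(\<Omega>' :: ('a \<times> (nat \<Rightarrow> nat)) measure) (M' :: nat \<Rightarrow> 'a \<times> (nat \<Rightarrow> nat) \<Rightarrow> real mat).
    prob_space \<Omega>' \<and>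
    semi_random_as \<Omega>' M' (\<sigma>\<^sup>2) \<and>
    (\<forall>N. distr \<Omega>' (mat_borel N) (M' N) = distr \<Omega> (mat_borel N) (M N))"
proof -
  interpret prob_space \<Omega> by fact
  interpret C: prob_space coins by (rule prob_space_coins)
  interpret P: pair_prob_space \<Omega> coins ..
  \<comment> \<open>The original space may carry no signs independent of \<open>F\<close>; an extra
    factor provides them.\<close>
  let ?\<Omega> = "\<Omega> \<Otimes>\<^sub>M coins"
  define s where "s N i x = coin_sign (snd x i)" for N i :: nat and x :: "'a \<times> (nat \<Rightarrow> nat)"
  define S where "S N x = (mat_diag N (\<lambda>i. coin_sign (snd x i)) :: real mat)"
    for N and x :: "'a \<times> (nat \<Rightarrow> nat)"
  define G where "G N A = A * mat_diag N (l N) * transpose_mat A" for N A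
  define \<Psi> where "\<Psi> N x = G N (F N (fst x))" for N and x :: "'a \<times> (nat \<Rightarrow> nat)"
  define M' where "M' N x = S N x * \<Psi> N x * S N x" for N and x :: "'a \<times> (nat \<Rightarrow> nat)"
  have FC: "F N \<omega> \<in> carrier_mat N N" if "\<omega> \<in> space \<Omega>" for N \<omega>
    using measurable_space[OF F_random that] by simp
  \<comment> \<open>Identity matrices on one side split the joint invariance into column
    permutations, used for the bounds, and row signs, used for the law.\<close>
  have id_sign: "1\<^sub>m N \<in> sign_mats N" for N
    unfolding mat_diag_one[symmetric] sign_mats_def by blast
  have id_perm: "1\<^sub>m N \<in> permutation_mats N" for N
    unfolding permutation_mats_def by (auto intro!: exI[of _ id] permutes_id)
  have col_inv: "distr \<Omega> (mat_borel N) (\<lambda>\<omega>. F N \<omega> * perm_mat N \<pi>) = distr \<Omega> (mat_borel N) (F N)"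
    if "\<pi> permutes {..<N}" for N \<pi>
  proof -
    have "perm_mat N \<pi> \<in> permutation_mats N"
      using that unfolding permutation_mats_def perm_mat_def by blast
    from F_invariant[OF id_sign this, symmetric] show ?thesis
      by (simp add: FC left_mult_one_mat[OF FC] cong: distr_cong)
  qed
  have row_inv: "distr \<Omega> (mat_borel N) (\<lambda>\<omega>. D * F N \<omega>) = distr \<Omega> (mat_borel N) (F N)"
    if "D \<in> sign_mats N" for N D
  proof -
    have "D * F N \<omega> * 1\<^sub>m N = D * F N \<omega>" if "\<omega> \<in> space \<Omega>" for \<omega>
      using FC[OF that] \<open>D \<in> sign_mats N\<close>
      by (intro right_mult_one_mat[of _ N] mult_carrier_mat[of _ N N]) (auto simp: sign_mats_def)
    then show ?thesis
      using F_invariant[OF that id_perm, symmetric] by (simp cong: distr_cong)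
  qed

  obtain L where L: "L > 0" and opL: "\<forall>\<^sub>F N in sequentially. \<bar>opnorm_mat (\<Lambda> N)\<bar> \<le> L"
    using \<Lambda>_bounded by (elim landau_o.bigE) auto
  have bd: "\<forall>\<^sub>F N in sequentially. \<forall>k<N. \<bar>l N k\<bar> \<le> L"
    using opL
  proof eventually_elim
    case (elim N)
    then show ?case
      using abs_le_opnorm_mat_diag[of _ N "l N"] unfolding \<Lambda>_diag by (meson abs_le_D1 order_trans)
  qed
  \<comment> \<open>The averages centring the eigenvalues and their squares are Tr(\<Lambda>)/N and
    Tr(\<Lambda>^2)/N, so the trace hypotheses are exactly their asymptotics.\<close>
  define m\<^sub>1 where "m\<^sub>1 N = (\<Sum>k<N. l N k) / real N" for N
  define m\<^sub>2 where "m\<^sub>2 N = (\<Sum>k<N. (l N k)\<^sup>2) / real N" for N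
  have m1: "m\<^sub>1 \<in> O(\<lambda>N. real N powr (- 1 / 2 + \<epsilon>))" if "\<epsilon> > 0" for \<epsilon>
    using \<Lambda>_trace[OF that] by (simp add: \<Lambda>_diag mat_trace_mat_diag m\<^sub>1_def[abs_def])
  have m2: "m\<^sub>2 \<longlonglongrightarrow> \<sigma>\<^sup>2"
    using \<Lambda>_trace_sq by (simp add: \<Lambda>_diag mat_trace_mat_diag m\<^sub>2_def[abs_def] power2_eq_square)
  have bd1: "\<forall>\<^sub>F N in sequentially. \<forall>k<N. \<bar>l N k - m\<^sub>1 N\<bar> \<le> 2 * L"
    using bd unfolding m\<^sub>1_def by eventually_elim (auto intro: abs_diff_average_le)
  have bd2: "\<forall>\<^sub>F N in sequentially. \<forall>k<N. \<bar>(l N k)\<^sup>2 - m\<^sub>2 N\<bar> \<le> 2 * L\<^sup>2"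
    using bd unfolding m\<^sub>2_def
  proof eventually_elim
    case (elim N)
    then have "\<bar>(l N k)\<^sup>2\<bar> \<le> L\<^sup>2" if "k < N" for k
      using that L by (simp add: abs_le_square_iff[symmetric])
    then show ?case by (auto intro: abs_diff_average_le)
  qed
  have "AE \<omega> in \<Omega>. \<forall>N. orthonormal_mat N (F N \<omega>)"
    using F_orthogonal by (simp add: AE_all_countable)
  moreover have "AE \<omega> in \<Omega>. \<forall>\<epsilon>>0. \<forall>\<^sub>F N in sequentially. \<forall>i<N. \<forall>j<N.
      \<bar>\<Sum>k<N. F N \<omega> $$ (i, k) * F N \<omega> $$ (j, k) * (l N k - m\<^sub>1 N)\<bar> \<le> real N powr (- 1 / 2 + \<epsilon>)"
    by (rule gram_form_AE_small_all[OF \<open>prob_space \<Omega>\<close> F_random col_inv F_delocalized _ bd1])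
      (auto simp: m\<^sub>1_def sum_diff_average)
  moreover have "AE \<omega> in \<Omega>. \<forall>\<epsilon>>0. \<forall>\<^sub>F N in sequentially. \<forall>i<N. \<forall>j<N.
      \<bar>\<Sum>k<N. F N \<omega> $$ (i, k) * F N \<omega> $$ (j, k) * ((l N k)\<^sup>2 - m\<^sub>2 N)\<bar> \<le> real N powr (- 1 / 2 + \<epsilon>)"
    by (rule gram_form_AE_small_all[OF \<open>prob_space \<Omega>\<close> F_random col_inv F_delocalized _ bd2])
      (auto simp: m\<^sub>2_def sum_diff_average)
  ultimately have "AE \<omega> in \<Omega>.
      (\<forall>\<epsilon>>0. (\<lambda>N. max_abs_entry (G N (F N \<omega>))) \<in> O(\<lambda>N. real N powr (- 1 / 2 + \<epsilon>))) \<and>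
      (\<lambda>N. opnorm_mat (G N (F N \<omega>))) \<in> O(\<lambda>N. 1) \<and>
      (\<forall>\<epsilon>>0. (\<lambda>N. max_abs_offdiag (G N (F N \<omega>) * transpose_mat (G N (F N \<omega>)))) \<in> O(\<lambda>N. real N powr (- 1 / 2 + \<epsilon>))) \<and>
      (\<lambda>N. max_diag_deviation (G N (F N \<omega>) * transpose_mat (G N (F N \<omega>))) (\<sigma>\<^sup>2)) \<longlonglongrightarrow> 0"
  proof eventually_elim
    case (elim \<omega>)
    show ?case
      unfolding G_def using elim L
      by (intro diag_conj_semi_random_conditions[OF _ _ bd _ _ m1 m2]) auto
  qed
  \<comment> \<open>The conditions involve the first coordinate only, whose law is that of the
    original space, so the null set pulls back along \<open>fst\<close>.\<close>
  then have conditions: "AE x in ?\<Omega>.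
      (\<forall>\<epsilon>>0. (\<lambda>N. max_abs_entry (\<Psi> N x)) \<in> O(\<lambda>N. real N powr (- 1 / 2 + \<epsilon>))) \<and>
      (\<lambda>N. opnorm_mat (\<Psi> N x)) \<in> O(\<lambda>N. 1) \<and>
      (\<forall>\<epsilon>>0. (\<lambda>N. max_abs_offdiag (\<Psi> N x * transpose_mat (\<Psi> N x))) \<in> O(\<lambda>N. real N powr (- 1 / 2 + \<epsilon>))) \<and>
      (\<lambda>N. max_diag_deviation (\<Psi> N x * transpose_mat (\<Psi> N x)) (\<sigma>\<^sup>2)) \<longlonglongrightarrow> 0"
    unfolding \<Psi>_def by (rule AE_distrD[OF measurable_fst[of \<Omega> coins], unfolded C.distr_pair_fst])

  have GF: "(\<lambda>\<omega>. G N (F N \<omega>)) \<in> \<Omega> \<rightarrow>\<^sub>M mat_borel N" for N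
    unfolding G_def by (rule measurable_compose[OF F_random measurable_diag_conj])
  then have \<Psi>_meas: "\<Psi> N \<in> ?\<Omega> \<rightarrow>\<^sub>M mat_borel N" for N
    unfolding \<Psi>_def by (rule measurable_compose[OF measurable_fst])
  then have M'_meas: "M' N \<in> ?\<Omega> \<rightarrow>\<^sub>M mat_borel N" for N
    unfolding M'_def S_def
    by (intro measurable_sign_conj measurable_compose[OF measurable_snd measurable_coin_sign])
  have snd_law: "distr ?\<Omega> (Pi\<^sub>M UNIV (\<lambda>_. measure_pmf (pmf_of_set {0, 1}))) snd =
      Pi\<^sub>M UNIV (\<lambda>_. measure_pmf (pmf_of_set {0, 1}))"
    using distr_pair_snd[OF \<open>prob_space \<Omega>\<close> prob_space_coins] unfolding coins_def .
  have snd_meas: "snd \<in> ?\<Omega> \<rightarrow>\<^sub>M Pi\<^sub>M UNIV (\<lambda>_. measure_pmf (pmf_of_set {0, 1}))"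
    using measurable_snd[of \<Omega> coins] unfolding coins_def .
  note coords = P.prob_space_axioms prob_space_measure_pmf snd_meas snd_law
  have sign_meas: "coin_sign \<in> measure_pmf (pmf_of_set {0, 1}) \<rightarrow>\<^sub>M count_space {-1, 1}"
    using coin_sign_cases by (intro measurableI) auto
  have s_indep: "P.indep_vars (\<lambda>_. count_space {-1, 1}) (s N) {..<N}" for N
    unfolding s_def
    by (rule P.indep_vars_compose2[OF indep_vars_PiM_coordinates[OF coords]]) (use sign_meas in auto)
  have s_law: "distr ?\<Omega> (count_space {-1, 1}) (s N i) = uniform_count_measure {-1, 1}" for N i
  proof -
    have "(\<lambda>x. snd x i) \<in> ?\<Omega> \<rightarrow>\<^sub>M measure_pmf (pmf_of_set {0, 1})"
      by (rule measurable_compose[OF snd_meas measurable_component_singleton[OF UNIV_I]])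
    from distr_distr[OF sign_meas this]
    have "distr ?\<Omega> (count_space {-1, 1}) (s N i) =
        distr (distr ?\<Omega> (measure_pmf (pmf_of_set {0, 1})) (\<lambda>x. snd x i)) (count_space {-1, 1}) coin_sign"
      by (simp only: s_def[abs_def] comp_def)
    then show ?thesis by (simp only: distr_PiM_coordinate[OF coords] distr_coin_sign)
  qed
  \<comment> \<open>Whole sequences are handled at once: a single map of the coins yields every
    \<open>S N\<close>, and a single map of the original outcome yields every
    \<open>\<Psi> N\<close>.\<close>
  have indep: "P.indep_var (Pi\<^sub>M UNIV mat_borel) (\<lambda>x N. S N x) (Pi\<^sub>M UNIV mat_borel) (\<lambda>x N. \<Psi> N x)"
  proof -
    have "(\<lambda>b N. mat_diag N (\<lambda>i. coin_sign (b i)) :: real mat) \<in> coins \<rightarrow>\<^sub>M Pi\<^sub>M UNIV mat_borel"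
      by (rule measurable_PiM_single') (auto intro: measurable_mat_diag measurable_coin_sign)
    moreover have "(\<lambda>\<omega> N. G N (F N \<omega>)) \<in> \<Omega> \<rightarrow>\<^sub>M Pi\<^sub>M UNIV mat_borel"
      using measurable_space[OF GF] by (intro measurable_PiM_single' GF) auto
    ultimately show ?thesis
      unfolding S_def \<Psi>_def
      by (rule indep_var_snd_fst[OF \<open>prob_space \<Omega>\<close> prob_space_coins])
  qed
  have "semi_random_as ?\<Omega> M' (\<sigma>\<^sup>2)"
    unfolding semi_random_as_def
    by (intro conjI allI exI[of _ s] exI[of _ S] exI[of _ \<Psi>] impI ballI M'_meas s_indep s_law
        \<Psi>_meas indep conditions) (simp_all add: S_def s_def M'_def)
  moreover have "distr ?\<Omega> (mat_borel N) (M' N) = distr \<Omega> (mat_borel N) (M N)" for N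
  proof -
    have "distr ?\<Omega> (mat_borel N) (M' N) = distr \<Omega> (mat_borel N) (\<lambda>\<omega>. G N (F N \<omega>))"
      unfolding M'_def S_def \<Psi>_def G_def
      by (rule distr_random_signs_conj[OF \<open>prob_space \<Omega>\<close> F_random row_inv])
    also have "\<dots> = distr \<Omega> (mat_borel N) (M N)"
      by (intro distr_cong) (auto simp: M_eq G_def \<Lambda>_diag)
    finally show ?thesis .
  qed
  ultimately show ?thesis using P.prob_space_axioms by blast
qed

end
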